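(* Let $\mathbb{X}$ be a standard Borel space, $\zeta\in\mathcal{P}(\mathbb{X})$, and let $\mathbb{Y}^1,\mathbb{Y}^2$ be compact standard Borel spaces, all fixed. The value of additional information to a decision maker is never negative for that decision maker in any zero-sum game in $\tilde{\mathbb{G}}_\zeta(\mathbb{X},\mathbb{Y}^1,\mathbb{Y}^2)$. That is, let $\mu$ and $\nu$ be information structures on $\mathbb{X}\times\mathbb{Y}^1\times\mathbb{Y}^2$ (with $\mathbb{X}$-marginal $\zeta$), each absolutely continuous with respect to a product measure $\zeta\otimes\bar Q^1\otimes\bar Q^2$ (for some reference probability measures $\bar Q^1,\bar Q^2$, possibly depending on the structure). If $\nu=\kappa^2\mu$ for some stochastic kernel $\kappa^2\in K^2$ (player 2, the maximizer, has more information under $\mu$), then $V^*(G,\mu)\ge V^*(G,\nu)$ for every $G\in\tilde{\mathbb{G}}_\zeta(\mathbb{X},\mathbb{Y}^1,\mathbb{Y}^2)$; and if $\nu=\kappa^1\mu$ for some stochastic kernel $\kappa^1\in K^1$ (player 1, the minimizer, has more information under $\mu$), then $V^*(G,\mu)\le V^*(G,\nu)$ for every $G\in\tilde{\mathbb{G}}_\zeta(\mathbb{X},\mathbb{Y}^1,\mathbb{Y}^2)$.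
   Context: A standard Borel space is a Borel subset of a complete separable metric space; $\mathcal{P}(\cdot)$ denotes Borel probability measures. The state of nature $x$ has law $\zeta$; player $i\in\{1,2\}$ observes only $y^i\in\mathbb{Y}^i$. Player 1 is the minimizer and player 2 the maximizer. Information structure: a joint probability measure $\mu(dx,dy^1,dy^2)$ on $\mathbb{X}\times\mathbb{Y}^1\times\mathbb{Y}^2$ with marginal $\zeta$ on $\mathbb{X}$. Absolute continuity with respect to a product measure means: there are probability measures $\bar Q^i$ on $\mathbb{Y}^i$ and an integrable $f$ with $\mu(A\times B\times C)=\int_{A\times B\times C} f(x,y^1,y^2)\,\zeta(dx)\bar Q^1(dy^1)\bar Q^2(dy^2)$ for all Borel $A\subset\mathbb{X}$, $B\subset\mathbb{Y}^1$, $C\subset\mathbb{Y}^2$. Game: a triple $G=(c,\mathbb{U}^1,\mathbb{U}^2)$ of standard Borel action spaces and a measurable bounded cost $c:\mathbb{X}\times\mathbb{U}^1\times\mathbb{U}^2\to\mathbb{R}$. The class $\tilde{\mathbb{G}}_\zeta(\mathbb{X},\mathbb{Y}^1,\mathbb{Y}^2)$ consists of all games in which $\mathbb{U}^1,\mathbb{U}^2$ are compact and $c$ is bounded and, for every $x$, continuous in the players' actions $(u^1,u^2)$. Policies: $\Gamma^i$ is the set of randomized policies of player $i$, i.e. stochastic kernels $\gamma^i(du^i|y^i)$ from $\mathbb{Y}^i$ to $\mathbb{U}^i$ (equivalently $u^i=\gamma^i(y^i,\omega^i)$ with independent noise $\omega^i$). The expected cost is $$V_G^\mu(\gamma^1,\gamma^2)=\int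 c(x,u^1,u^2)\,\gamma^1(du^1|y^1)\gamma^2(du^2|y^2)\,\mu(dx,dy^1,dy^2).$$ An equilibrium is a pair with $\inf_{\gamma^1\in\Gamma^1}V_G^\mu(\gamma^1,\gamma^{2,*})=V_G^\mu(\gamma^{1,*},\gamma^{2,*})=\sup_{\gamma^2\in\Gamma^2}V_G^\mu(\gamma^{1,*},\gamma^2)$; $V^*(G,\mu)$ denotes $V_G^\mu$ at equilibrium policies. $K^i$ is the set of all stochastic kernels from $\mathbb{Y}^i$ to $\mathbb{Y}^i$. For $\kappa^i\in K^i$, $\kappa^i\mu$ is the information structure $(\kappa^i\mu)(B,dy^{-i},dx)=\int_{\mathbb{Y}^i}\kappa^i(B|y^i)\,\mu(dy^i,dy^{-i},dx)$, $B\in\mathcal{B}(\mathbb{Y}^i)$, where $-i$ is the other player. *)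

theory Defs
  imports "HOL-Probability.Probability"
begin

text \<open>
  A standard Borel space is represented by a Borel subset \<open>S\<close> of a type of class
  \<open>polish_space\<close>, equipped with the trace of the Borel sigma-algebra.  For compact spaces
  \<open>compact S\<close> suffices, since compact sets are Borel.
\<close>

abbreviation bsp :: "'a::topological_space set \<Rightarrow> 'a measure" where
  "bsp S \<equiv> restrict_space borel S"

abbreviation triple_space ::
  "'x::topological_space set \<Rightarrow> 'y1::topological_space set \<Rightarrow> 'y2::topological_space set
    \<Rightarrow> ('x \<times> 'y1 \<times> 'y2) measure" where
  "triple_space X Y1 Y2 \<equiv> bsp X \<Otimes>\<^sub>M (bsp Y1 \<Otimes>\<^sub>M bsp Y2)"

definition prob_measures :: "'a::topological_space set \<Rightarrow> 'a measure set" where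
  "prob_measures S = space (prob_algebra (bsp S))"

definition kernels ::
  "'a::topological_space set \<Rightarrow> 'b::topological_space set \<Rightarrow> ('a \<Rightarrow> 'b measure) set" where
  "kernels S T = bsp S \<rightarrow>\<^sub>M prob_algebra (bsp T)"

definition info_structures ::
  "'x::topological_space set \<Rightarrow> 'y1::topological_space set \<Rightarrow> 'y2::topological_space set
    \<Rightarrow> 'x measure \<Rightarrow> ('x \<times> 'y1 \<times> 'y2) measure set" where
  "info_structures X Y1 Y2 \<zeta> =
     {\<mu> \<in> space (prob_algebra (triple_space X Y1 Y2)). distr \<mu> (bsp X) fst = \<zeta>}"

definition ac_product ::
  "'x::topological_space set \<Rightarrow> 'y1::topological_space set \<Rightarrow> 'y2::topological_space set
    \<Rightarrow> 'x measure \<Rightarrow> ('x \<times> 'y1 \<times> 'y2) measure \<Rightarrow> bool" where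
  "ac_product X Y1 Y2 \<zeta> \<mu> \<longleftrightarrow>
     (\<exists>Q1 \<in> prob_measures Y1. \<exists>Q2 \<in> prob_measures Y2. \<exists>f :: 'x \<times> 'y1 \<times> 'y2 \<Rightarrow> real.
        integrable (\<zeta> \<Otimes>\<^sub>M (Q1 \<Otimes>\<^sub>M Q2)) f \<and>
        (\<forall>A \<in> sets (bsp X). \<forall>B \<in> sets (bsp Y1). \<forall>C \<in> sets (bsp Y2).
           measure \<mu> (A \<times> B \<times> C) = (LINT z : A \<times> B \<times> C | \<zeta> \<Otimes>\<^sub>M (Q1 \<Otimes>\<^sub>M Q2). f z)))"

record ('x, 'u1, 'u2) game =
  cost :: "'x \<Rightarrow> 'u1 \<Rightarrow> 'u2 \<Rightarrow> real"
  actions1 :: "'u1 set"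
  actions2 :: "'u2 set"

definition compact_games ::
  "'x::polish_space set \<Rightarrow> ('x, 'u1::polish_space, 'u2::polish_space) game set" where
  "compact_games X =
     {G. compact (actions1 G) \<and> compact (actions2 G) \<and>
         (\<lambda>(x, u1, u2). cost G x u1 u2)
           \<in> borel_measurable (triple_space X (actions1 G) (actions2 G)) \<and>
         (\<exists>b. \<forall>x\<in>X. \<forall>u1\<in>actions1 G. \<forall>u2\<in>actions2 G. \<bar>cost G x u1 u2\<bar> \<le> b) \<and>
         (\<forall>x\<in>X. continuous_on (actions1 G \<times> actions2 G) (\<lambda>(u1, u2). cost G x u1 u2))}"

definition expected_cost ::
  "('x, 'u1, 'u2) game \<Rightarrow> ('x \<times> 'y1 \<times> 'y2) measure
    \<Rightarrow> ('y1 \<Rightarrow> 'u1 measure) \<Rightarrow> ('y2 \<Rightarrow> 'u2 measure) \<Rightarrow> real" where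
  "expected_cost G \<mu> \<gamma>1 \<gamma>2 =
     (\<integral>(x, y1, y2). (\<integral>u1. (\<integral>u2. cost G x u1 u2 \<partial>\<gamma>2 y2) \<partial>\<gamma>1 y1) \<partial>\<mu>)"

text \<open>Player 1 minimizes and player 2 maximizes.  For games in \<open>compact_games\<close> the infimum and
  supremum below range over nonempty bounded sets of reals.\<close>

definition equilibrium ::
  "'y1::topological_space set \<Rightarrow> 'y2::topological_space set
    \<Rightarrow> ('x, 'u1::topological_space, 'u2::topological_space) game \<Rightarrow> ('x \<times> 'y1 \<times> 'y2) measure
    \<Rightarrow> ('y1 \<Rightarrow> 'u1 measure) \<Rightarrow> ('y2 \<Rightarrow> 'u2 measure) \<Rightarrow> bool" where
  "equilibrium Y1 Y2 G \<mu> \<gamma>1 \<gamma>2 \<longleftrightarrow>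
     \<gamma>1 \<in> kernels Y1 (actions1 G) \<and> \<gamma>2 \<in> kernels Y2 (actions2 G) \<and>
     (INF \<gamma> \<in> kernels Y1 (actions1 G). expected_cost G \<mu> \<gamma> \<gamma>2) = expected_cost G \<mu> \<gamma>1 \<gamma>2 \<and>
     expected_cost G \<mu> \<gamma>1 \<gamma>2 = (SUP \<gamma> \<in> kernels Y2 (actions2 G). expected_cost G \<mu> \<gamma>1 \<gamma>)"

text \<open>All equilibria of a zero-sum game have the same cost, so the description below is
  well defined as soon as an equilibrium exists; it carries no information otherwise.\<close>

definition game_value ::
  "'y1::topological_space set \<Rightarrow> 'y2::topological_space set
    \<Rightarrow> ('x, 'u1::topological_space, 'u2::topological_space) game
    \<Rightarrow> ('x \<times> 'y1 \<times> 'y2) measure \<Rightarrow> real" where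
  "game_value Y1 Y2 G \<mu> =
     (THE v. \<exists>\<gamma>1 \<gamma>2. equilibrium Y1 Y2 G \<mu> \<gamma>1 \<gamma>2 \<and> v = expected_cost G \<mu> \<gamma>1 \<gamma>2)"

text \<open>The information structures \<open>\<kappa>\<^sup>i\<mu>\<close>: the signal of player \<open>i\<close> is resampled through the kernel,
  state and other signal being kept.  The lemmas \<open>garble1_rect\<close> and \<open>garble2_rect\<close> recover the usual
  formula on rectangles.\<close>

definition garble1 ::
  "'x::topological_space set \<Rightarrow> 'y1::topological_space set \<Rightarrow> 'y2::topological_space set
    \<Rightarrow> ('y1 \<Rightarrow> 'y1 measure) \<Rightarrow> ('x \<times> 'y1 \<times> 'y2) measure \<Rightarrow> ('x \<times> 'y1 \<times> 'y2) measure" where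
  "garble1 X Y1 Y2 \<kappa> \<mu> =
     \<mu> \<bind> (\<lambda>(x, y1, y2). \<kappa> y1 \<bind> (\<lambda>y1'. return (triple_space X Y1 Y2) (x, y1', y2)))"

definition garble2 ::
  "'x::topological_space set \<Rightarrow> 'y1::topological_space set \<Rightarrow> 'y2::topological_space set
    \<Rightarrow> ('y2 \<Rightarrow> 'y2 measure) \<Rightarrow> ('x \<times> 'y1 \<times> 'y2) measure \<Rightarrow> ('x \<times> 'y1 \<times> 'y2) measure" where
  "garble2 X Y1 Y2 \<kappa> \<mu> =
     \<mu> \<bind> (\<lambda>(x, y1, y2). \<kappa> y2 \<bind> (\<lambda>y2'. return (triple_space X Y1 Y2) (x, y1, y2')))"

lemma garble1_rect:
  assumes mu: "\<mu> \<in> space (prob_algebra (triple_space X Y1 Y2))" and k: "\<kappa> \<in> kernels Y1 Y1"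
    and A: "A \<in> sets (bsp X)" and B: "B \<in> sets (bsp Y1)" and C: "C \<in> sets (bsp Y2)"
  shows "emeasure (garble1 X Y1 Y2 \<kappa> \<mu>) (A \<times> B \<times> C) =
    (\<integral>\<^sup>+(x, y1, y2). emeasure (\<kappa> y1) B * indicator (A \<times> C) (x, y2) \<partial>\<mu>)"
proof -
  let ?M = "triple_space X Y1 Y2"
  have k'[measurable]: "\<kappa> \<in> bsp Y1 \<rightarrow>\<^sub>M subprob_algebra (bsp Y1)"
    using k by (auto simp: kernels_def measurable_prob_algebraD)
  have sm[measurable_cong]: "sets \<mu> = sets ?M" and ne: "space \<mu> \<noteq> {}"
    using mu by (auto simp: space_prob_algebra prob_space.not_empty)
  have rect[measurable]: "A \<times> B \<times> C \<in> sets ?M"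
    by (intro pair_measureI A B C)
  have sp: "space \<mu> = space ?M" using sm by (rule sets_eq_imp_space_eq)
  have "emeasure (garble1 X Y1 Y2 \<kappa> \<mu>) (A \<times> B \<times> C) =
    (\<integral>\<^sup>+z. emeasure (case z of (x, y1, y2) \<Rightarrow> \<kappa> y1 \<bind> (\<lambda>y1'. return ?M (x, y1', y2))) (A \<times> B \<times> C) \<partial>\<mu>)"
    unfolding garble1_def by (rule emeasure_bind[where N="?M", OF ne]) measurable
  also have "\<dots> = (\<integral>\<^sup>+(x, y1, y2). emeasure (\<kappa> y1) B * indicator (A \<times> C) (x, y2) \<partial>\<mu>)"
  proof (rule nn_integral_cong, clarify)
    fix x y1 y2 assume "(x, y1, y2) \<in> space \<mu>"
    then have x: "x \<in> space (bsp X)" and y1: "y1 \<in> space (bsp Y1)" and y2: "y2 \<in> space (bsp Y2)"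
      by (auto simp: sp space_pair_measure)
    have sk: "sets (\<kappa> y1) = sets (bsp Y1)"
      using k' y1 by (rule sets_kernel)
    have nek: "space (\<kappa> y1) \<noteq> {}"
      using y1 sets_eq_imp_space_eq[OF sk] by auto
    have "(\<lambda>y1'. (x, y1', y2)) \<in> \<kappa> y1 \<rightarrow>\<^sub>M ?M"
      by (intro measurable_Pair measurable_const measurable_ident_sets sk x y2)
    then have rm: "(\<lambda>y1'. return ?M (x, y1', y2)) \<in> \<kappa> y1 \<rightarrow>\<^sub>M subprob_algebra ?M"
      by (rule measurable_compose) (rule return_measurable)
    have "emeasure (\<kappa> y1 \<bind> (\<lambda>y1'. return ?M (x, y1', y2))) (A \<times> B \<times> C) =
       (\<integral>\<^sup>+y1'. emeasure (return ?M (x, y1', y2)) (A \<times> B \<times> C) \<partial>\<kappa> y1)"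
      by (rule emeasure_bind[where N="?M", OF nek rm rect])
    also have "\<dots> = (\<integral>\<^sup>+y1'. indicator (A \<times> C) (x, y2) * indicator B y1' \<partial>\<kappa> y1)"
      by (intro nn_integral_cong, subst emeasure_return[OF rect]) (auto split: split_indicator)
    also have "\<dots> = emeasure (\<kappa> y1) B * indicator (A \<times> C) (x, y2)"
      by (subst nn_integral_cmult_indicator) (auto simp: mult.commute sk B)
    finally show "emeasure (\<kappa> y1 \<bind> (\<lambda>y1'. return ?M (x, y1', y2))) (A \<times> B \<times> C) =
       emeasure (\<kappa> y1) B * indicator (A \<times> C) (x, y2)" .
  qed
  finally show ?thesis .
qed

lemma garble2_rect:
  assumes mu: "\<mu> \<in> space (prob_algebra (triple_space X Y1 Y2))" and k: "\<kappa> \<in> kernels Y2 Y2"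
    and A: "A \<in> sets (bsp X)" and B: "B \<in> sets (bsp Y1)" and C: "C \<in> sets (bsp Y2)"
  shows "emeasure (garble2 X Y1 Y2 \<kappa> \<mu>) (A \<times> B \<times> C) =
    (\<integral>\<^sup>+(x, y1, y2). emeasure (\<kappa> y2) C * indicator (A \<times> B) (x, y1) \<partial>\<mu>)"
proof -
  let ?M = "triple_space X Y1 Y2"
  have k'[measurable]: "\<kappa> \<in> bsp Y2 \<rightarrow>\<^sub>M subprob_algebra (bsp Y2)"
    using k by (auto simp: kernels_def measurable_prob_algebraD)
  have sm[measurable_cong]: "sets \<mu> = sets ?M" and ne: "space \<mu> \<noteq> {}"
    using mu by (auto simp: space_prob_algebra prob_space.not_empty)
  have rect[measurable]: "A \<times> B \<times> C \<in> sets ?M"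
    by (intro pair_measureI A B C)
  have sp: "space \<mu> = space ?M" using sm by (rule sets_eq_imp_space_eq)
  have "emeasure (garble2 X Y1 Y2 \<kappa> \<mu>) (A \<times> B \<times> C) =
    (\<integral>\<^sup>+z. emeasure (case z of (x, y1, y2) \<Rightarrow> \<kappa> y2 \<bind> (\<lambda>y2'. return ?M (x, y1, y2'))) (A \<times> B \<times> C) \<partial>\<mu>)"
    unfolding garble2_def by (rule emeasure_bind[where N="?M", OF ne]) measurable
  also have "\<dots> = (\<integral>\<^sup>+(x, y1, y2). emeasure (\<kappa> y2) C * indicator (A \<times> B) (x, y1) \<partial>\<mu>)"
  proof (rule nn_integral_cong, clarify)
    fix x y1 y2 assume "(x, y1, y2) \<in> space \<mu>"
    then have x: "x \<in> space (bsp X)" and y1: "y1 \<in> space (bsp Y1)" and y2: "y2 \<in> space (bsp Y2)"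
      by (auto simp: sp space_pair_measure)
    have sk: "sets (\<kappa> y2) = sets (bsp Y2)"
      using k' y2 by (rule sets_kernel)
    have nek: "space (\<kappa> y2) \<noteq> {}"
      using y2 sets_eq_imp_space_eq[OF sk] by auto
    have "(\<lambda>y2'. (x, y1, y2')) \<in> \<kappa> y2 \<rightarrow>\<^sub>M ?M"
      by (intro measurable_Pair measurable_const measurable_ident_sets sk x y1)
    then have rm: "(\<lambda>y2'. return ?M (x, y1, y2')) \<in> \<kappa> y2 \<rightarrow>\<^sub>M subprob_algebra ?M"
      by (rule measurable_compose) (rule return_measurable)
    have "emeasure (\<kappa> y2 \<bind> (\<lambda>y2'. return ?M (x, y1, y2'))) (A \<times> B \<times> C) =
       (\<integral>\<^sup>+y2'. emeasure (return ?M (x, y1, y2')) (A \<times> B \<times> C) \<partial>\<kappa> y2)"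
      by (rule emeasure_bind[where N="?M", OF nek rm rect])
    also have "\<dots> = (\<integral>\<^sup>+y2'. indicator (A \<times> B) (x, y1) * indicator C y2' \<partial>\<kappa> y2)"
      by (intro nn_integral_cong, subst emeasure_return[OF rect]) (auto split: split_indicator)
    also have "\<dots> = emeasure (\<kappa> y2) C * indicator (A \<times> B) (x, y1)"
      by (subst nn_integral_cmult_indicator) (auto simp: mult.commute sk C)
    finally show "emeasure (\<kappa> y2 \<bind> (\<lambda>y2'. return ?M (x, y1, y2'))) (A \<times> B \<times> C) =
       emeasure (\<kappa> y2) C * indicator (A \<times> B) (x, y1)" .
  qed
  finally show ?thesis .
qed

end

theory Submission
  imports Defs
begin

text \<open>
  A policy that uses the garbled signal is simulated under the original structure by composing
  it with the garbling kernel, so the values compare as soon as both games have saddle points.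
  The expected cost is affine in each policy, so that a saddle point exists if sublevel sets of
  policies with the finite intersection property have a common point.  This convex form of
  compactness is obtained from Hilbert space geometry instead of a topology on policies: coding
  actions by reals turns policies into families of distribution functions, elements of almost
  minimal \<open>L\<^sup>2\<close> norm along a directed family of convex sets form a Cauchy sequence by the
  parallelogram law, and the almost sure limit of their distribution functions defines a policy.
  The convergence obtained is weak convergence of the action laws for almost every signal, which
  passes to the expected cost by continuity of the cost and dominated convergence.
\<close>

section \<open>Coding compact spaces by reals\<close>

text \<open>The family of sublevel sets may be uncountable, and the common point must be the same
  for all of them, so extracting a limit separately for each set does not help. Norm minimisation
  resolves this: a countable decreasing chain already attains the supremum of the minimal norms, and
  near minimisers that any further set shares with the chain stay close to those chosen along the
  chain. One limit therefore serves all sets, approached from inside each of them. The convergence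
  is in norm, hence almost sure along a geometric rate, and not merely weak in L2. This is decisive
  because the expected cost integrates over the state and both signals jointly, with a cost that is
  merely measurable in the state: convergence for almost every signal passes through such an
  integral. Continuity of the expected cost is obtained in each policy separately, which suffices
  because every sublevel set fixes the opposing policy.\<close>

text \<open>The code lists, as base 3 digits, membership in the sets of a countable base. Finitely many
  base sets of small diameter cover the space, so codes that share enough initial digits belong to
  nearby points: decoding is uniformly continuous and extends to the closure of the codes.\<close>
lemma compact_real_code:
  fixes U :: "'u::polish_space set"
  assumes U: "compact U"
  obtains r :: "'u \<Rightarrow> real" and C q where
    "r \<in> borel_measurable borel" "\<And>u. 0 \<le> r u \<and> r u \<le> 1" "closed C" "r ` U \<subseteq> C"
    "continuous_on C q" "q ` C \<subseteq> U" "\<And>u. u \<in> U \<Longrightarrow> q (r u) = u"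
proof -
  obtain \<B> :: "'u set set" where cB: "countable \<B>" and tB: "topological_basis \<B>"
    using ex_countable_basis by blast
  \<comment> \<open>Adding the empty set makes the countable family nonempty, as the enumeration by
    \<open>from_nat_into\<close> requires.\<close>
  define \<B>' where "\<B>' = insert {} \<B>"
  define B where "B = from_nat_into \<B>'"
  have ne: "\<B>' \<noteq> {}" and cB': "countable \<B>'"
    using cB by (auto simp: \<B>'_def)
  have rangeB: "range B = \<B>'"
    unfolding B_def using ne cB' by (rule range_from_nat_into)
  have openB: "open (B i)" for i
  proof -
    have "B i \<in> \<B>'" using rangeB by blast
    then show ?thesis using tB by (auto simp: \<B>'_def topological_basis_open)
  qed
  have [measurable]: "B i \<in> sets borel" for i
    using openB by simp
  define a where "a i u = indicator (B i) u * (1/3::real) ^ Suc i" for i u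
  define r where "r u = (\<Sum>i. a i u)" for u
  have geo: "(\<lambda>i. (1/3::real) ^ Suc (i + k)) sums ((1/3) ^ k / 2)" for k
  proof -
    have "(\<lambda>i. (1/3) ^ Suc k * (1/3::real) ^ i) sums ((1/3) ^ Suc k * (1 / (1 - 1/3)))"
      by (intro sums_mult geometric_sums) auto
    then show ?thesis by (simp add: power_add mult_ac)
  qed
  have a_bd: "0 \<le> a i u" "a i u \<le> (1/3) ^ Suc i" for i u
    by (auto simp: a_def indicator_def)
  have summ: "summable (\<lambda>i. a i u)" for u
    by (rule summable_comparison_test'[OF sums_summable[OF geo[of 0]], of 0])
      (use a_bd in \<open>auto simp del: power_Suc\<close>)
  \<comment> \<open>With digits 0 and 1 in base 3 the whole tail after position \<open>i\<close> is
    at most half of the digit weight \<open>(1/3) ^ Suc i\<close>, so the first differing digit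
    cannot be compensated. In base 2 it could be.\<close>
  have gap: "\<bar>r u - r v\<bar> \<ge> (1/3) ^ Suc i / 2"
    if agree: "\<And>j. j < i \<Longrightarrow> u \<in> B j \<longleftrightarrow> v \<in> B j" and diff: "(u \<in> B i) \<noteq> (v \<in> B i)" for u v i
  proof -
    let ?d = "\<lambda>j. a j u - a j v"
    have sd: "summable ?d" by (intro summable_diff summ)
    have "r u - r v = (\<Sum>j. ?d j)"
      unfolding r_def by (rule suminf_diff[OF summ summ])
    also have "\<dots> = (\<Sum>j. ?d (j + Suc i)) + (\<Sum>j<Suc i. ?d j)"
      by (rule suminf_split_initial_segment[OF sd])
    also have "(\<Sum>j<Suc i. ?d j) = ?d i"
      using agree by (auto simp: a_def indicator_def intro!: sum.neutral)
    finally have e: "r u - r v = (\<Sum>j. ?d (j + Suc i)) + ?d i" .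
    have "norm (\<Sum>j. ?d (j + Suc i)) \<le> (\<Sum>j. (1/3::real) ^ Suc (j + Suc i))"
    proof (rule norm_suminf_le)
      show "norm (?d (j + Suc i)) \<le> (1/3) ^ Suc (j + Suc i)" for j
        using a_bd[of "j + Suc i" u] a_bd[of "j + Suc i" v] by (auto simp del: power_Suc)
      show "summable (\<lambda>j. (1/3::real) ^ Suc (j + Suc i))"
        using sums_summable[OF geo[of "Suc i"]] .
    qed
    also have "\<dots> = (1/3) ^ Suc i / 2"
      using sums_unique[OF geo[of "Suc i"]] by simp
    finally have t: "\<bar>\<Sum>j. ?d (j + Suc i)\<bar> \<le> (1/3) ^ Suc i / 2" by simp
    have "\<bar>?d i\<bar> = (1/3) ^ Suc i"
      using diff by (auto simp: a_def indicator_def)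
    then show ?thesis using e t by linarith
  qed
  have uc: "\<exists>\<delta>>0. \<forall>u\<in>U. \<forall>v\<in>U. \<bar>r u - r v\<bar> < \<delta> \<longrightarrow> dist u v < e" if e: "e > 0" for e
  proof -
    have "\<exists>i. u \<in> B i \<and> B i \<subseteq> ball u (e/2)" for u
    proof -
      have "open (ball u (e/2))" "u \<in> ball u (e/2)" using e by auto
      then obtain B' where "B' \<in> \<B>" "u \<in> B'" "B' \<subseteq> ball u (e/2)"
        using topological_basisE[OF tB] by metis
      then show ?thesis using rangeB unfolding \<B>'_def by (metis insertCI rangeE)
    qed
    then obtain i where i: "\<And>u. u \<in> B (i u)" "\<And>u. B (i u) \<subseteq> ball u (e/2)" by metis
    have "\<exists>D\<subseteq>U. finite D \<and> U \<subseteq> (\<Union>u\<in>D. B (i u))"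
      by (rule compactE_image[OF U, of U "\<lambda>u. B (i u)"]) (use openB i in auto)
    then obtain D where D: "finite D" "U \<subseteq> (\<Union>u\<in>D. B (i u))" by blast
    \<comment> \<open>\<open>m\<close> bounds the indices used by the finite cover. Codes closer
      than the gap at \<open>m\<close> agree in all digits up to \<open>m\<close>, so a covering set
      that contains \<open>u\<close> also contains \<open>v\<close>, and both lie in one ball of
      radius \<open>e/2\<close>.\<close>
    obtain m where m: "\<And>u. u \<in> D \<Longrightarrow> i u \<le> m"
      using finite_nat_set_iff_bounded_le[of "i ` D"] D(1) by auto
    show ?thesis
    proof (intro exI[of _ "(1/3) ^ Suc m / 2"] conjI ballI impI)
      fix u v assume uv: "u \<in> U" "v \<in> U" "\<bar>r u - r v\<bar> < (1/3) ^ Suc m / 2"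
      have agree: "u \<in> B j \<longleftrightarrow> v \<in> B j" if "j \<le> m" for j
      proof (rule ccontr)
        assume neq: "(u \<in> B j) \<noteq> (v \<in> B j)"
        define k where "k = (LEAST j. (u \<in> B j) \<noteq> (v \<in> B j))"
        have k: "(u \<in> B k) \<noteq> (v \<in> B k)" "k \<le> j"
          unfolding k_def using neq by (rule LeastI, rule Least_le)
        have "(u \<in> B l) \<longleftrightarrow> (v \<in> B l)" if "l < k" for l
          using not_less_Least[of l] that unfolding k_def by blast
        then have "(1/3) ^ Suc k / 2 \<le> \<bar>r u - r v\<bar>" using gap k(1) by blast
        moreover have "(1/3::real) ^ Suc m \<le> (1/3) ^ Suc k"
          using k(2) that by (intro power_decreasing) auto
        ultimately show False using uv(3) by linarith
      qed
      obtain w where w: "w \<in> D" "u \<in> B (i w)" using D(2) uv(1) by auto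
      then have "v \<in> B (i w)" using agree m by blast
      then have "dist w u < e/2" "dist w v < e/2" using i(2)[of w] w by auto
      then show "dist u v < e" by (metis dist_commute dist_triangle_half_l)
    qed auto
  qed
  define p where "p = inv_into U r"
  have inj: "inj_on r U"
  proof (rule inj_onI, rule ccontr)
    fix u v assume "u \<in> U" "v \<in> U" "r u = r v" "u \<noteq> v"
    then show False using uc[of "dist u v"] by force
  qed
  have p: "p (r u) = u" if "u \<in> U" for u
    unfolding p_def using inj that by (rule inv_into_f_f)
  have "uniformly_continuous_on (r ` U) p"
    unfolding uniformly_continuous_on_def
  proof (intro allI impI)
    fix e :: real assume "0 < e"
    then obtain \<delta> where "\<delta> > 0" "\<forall>u\<in>U. \<forall>v\<in>U. \<bar>r u - r v\<bar> < \<delta> \<longrightarrow> dist u v < e" using uc by blast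
    then show "\<exists>d>0. \<forall>x\<in>r ` U. \<forall>x'\<in>r ` U. dist x' x < d \<longrightarrow> dist (p x') (p x) < e"
      by (intro exI[of _ \<delta>]) (auto simp: p dist_real_def)
  qed
  then obtain q where q: "uniformly_continuous_on (closure (r ` U)) q"
      "\<And>x. x \<in> r ` U \<Longrightarrow> p x = q x"
    by (rule uniformly_continuous_on_extension_on_closure) blast
  show ?thesis
  proof (rule that[of r "closure (r ` U)" q])
    show "r \<in> borel_measurable borel"
      unfolding r_def a_def by measurable
    show "0 \<le> r u \<and> r u \<le> 1" for u
    proof
      show "0 \<le> r u" unfolding r_def by (intro suminf_nonneg summ a_bd)
      have "r u \<le> (\<Sum>i. (1/3) ^ Suc (i + 0))"
        unfolding r_def using a_bd by (intro suminf_le summ sums_summable[OF geo]) auto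
      then show "r u \<le> 1" using sums_unique[OF geo[of 0]] by simp
    qed
    show "continuous_on (closure (r ` U)) q"
      using q(1) by (rule uniformly_continuous_imp_continuous)
    then show "q ` closure (r ` U) \<subseteq> U"
      by (rule image_closure_subset) (use q(2) p compact_imp_closed[OF U] in auto)
    show "q (r u) = u" if "u \<in> U" for u using q(2) p that by auto
  qed (auto simp: closure_subset)
qed

section \<open>Kernels from limits of distribution functions\<close>

text \<open>Taking the limit superior makes the limit a distribution function also at those \<open>y\<close>
  where the sequence does not converge, so that the limit is a kernel everywhere.\<close>
lemma limit_cdf_kernel:
  fixes m :: "nat \<Rightarrow> 'y \<Rightarrow> real measure"
  assumes m: "\<And>n. m n \<in> M \<rightarrow>\<^sub>M prob_algebra borel"
    and supp: "\<And>n y. y \<in> space M \<Longrightarrow> measure (m n y) {0..1} = 1"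
  obtains K where "K \<in> M \<rightarrow>\<^sub>M prob_algebra borel"
    "\<And>y s. \<lbrakk>y \<in> space M; \<And>t. t \<in> \<rat> \<Longrightarrow> convergent (\<lambda>n. cdf (m n y) t);
       \<And>n. real_distribution (s n);
       \<And>t. t \<in> \<rat> \<Longrightarrow> (\<lambda>n. cdf (s n) t - cdf (m n y) t) \<longlonglongrightarrow> 0\<rbrakk> \<Longrightarrow> weak_conv_m s (K y)"
proof -
  have rd: "real_distribution (m n y)" if "y \<in> space M" for n y
    using measurable_space[OF m that, of n]
    by (auto simp: space_prob_algebra real_distribution_def real_distribution_axioms_def)
  define H where "H n y t = cdf (m n y) t" for n y t
  have H_mono: "H n y s \<le> H n y t" if "y \<in> space M" "s \<le> t" for n y s t
    unfolding H_def using finite_borel_measure.cdf_nondecreasing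
      [OF real_distribution.finite_borel_measure_M[OF rd[OF that(1)]] that(2)] .
  have H_bd: "0 \<le> H n y t" "H n y t \<le> 1" if "y \<in> space M" for n y t
    using real_distribution.cdf_bounded_prob[OF rd[OF that]]
    by (auto simp: H_def cdf_def)
  \<comment> \<open>The common support in the unit interval pins the distribution functions outside
    it for every \<open>n\<close>, so no mass escapes to infinity in the limit.\<close>
  have H0: "H n y t = 0" if "y \<in> space M" "t < 0" for n y t
  proof -
    interpret real_distribution "m n y" using rd that by blast
    have "prob ({..t} \<union> {0..1}) = prob {..t} + prob {0..1}"
      using that by (intro finite_measure_Union) auto
    then show ?thesis using supp[OF that(1), of n] prob_le_1[of "{..t} \<union> {0..1}"]
        measure_nonneg[of "m n y" "{..t}"]
      unfolding H_def cdf_def by linarith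
  qed
  have H1: "H n y t = 1" if "y \<in> space M" "1 \<le> t" for n y t
  proof -
    interpret real_distribution "m n y" using rd that by blast
    have "prob {0..1} \<le> prob {..t}"
      using that by (intro finite_measure_mono) auto
    then show ?thesis using supp[OF that(1), of n] prob_le_1[of "{..t}"]
      unfolding H_def cdf_def by linarith
  qed
  have [measurable]: "(\<lambda>y. H n y t) \<in> borel_measurable M" for n t
    unfolding H_def cdf_def
    by (rule measurable_compose[OF measurable_prob_algebraD[OF m] measurable_measure_subprob_algebra]) simp
  define L where "L y t = limsup (\<lambda>n. ereal (H n y t))" for y t
  define G where "G y t = real_of_ereal (L y t)" for y t
  have L_bd: "0 \<le> L y t" "L y t \<le> 1" if "y \<in> space M" for y t
  proof -
    show "0 \<le> L y t"
      unfolding L_def using H_bd[OF that]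
      by (intro order.trans[OF _ Liminf_le_Limsup] Liminf_bounded) auto
    show "L y t \<le> 1"
      unfolding L_def using H_bd[OF that] by (intro Limsup_bounded) auto
  qed
  have G_L: "ereal (G y t) = L y t" if "y \<in> space M" for y t
    unfolding G_def using L_bd[OF that, of t] by (intro ereal_real') auto
  have G_mono: "G y s \<le> G y t" if "y \<in> space M" "s \<le> t" for y s t
  proof -
    have "L y s \<le> L y t"
      unfolding L_def by (intro Limsup_mono always_eventually) (auto intro: H_mono that)
    then show ?thesis using G_L[OF that(1)] by (metis ereal_less_eq(3))
  qed
  have G_bd: "0 \<le> G y t" "G y t \<le> 1" if "y \<in> space M" for y t
    using L_bd[OF that] G_L[OF that] by (metis ereal_less_eq(5), metis ereal_less_eq(6))
  have G0: "G y t = 0" if "y \<in> space M" "t < 0" for y t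
    unfolding G_def L_def by (simp add: H0[OF that] Limsup_const)
  have G1: "G y t = 1" if "y \<in> space M" "1 \<le> t" for y t
    unfolding G_def L_def by (simp add: H1[OF that] Limsup_const)
  have G_lim: "(\<lambda>n. H n y t) \<longlonglongrightarrow> G y t" if "y \<in> space M" and c: "convergent (\<lambda>n. H n y t)" for y t
  proof -
    obtain l where l: "(\<lambda>n. H n y t) \<longlonglongrightarrow> l" using c by (auto simp: convergent_def)
    then have "L y t = ereal l"
      unfolding L_def by (intro lim_imp_Limsup) auto
    then show ?thesis using l by (simp add: G_def)
  qed
  have [measurable]: "(\<lambda>y. G y t) \<in> borel_measurable M" for t
    unfolding G_def L_def by measurable
  \<comment> \<open>The limit \<open>G\<close> need not be right continuous. Taking infima over
    strictly larger rationals repairs this, uses \<open>G\<close> only where convergence is known,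
    and keeps measurability in \<open>y\<close> because the infimum is countable.\<close>
  define R where "R x = {t \<in> \<rat>. x < (t::real)}" for x
  have R_ne: "R x \<noteq> {}" for x
    using Rats_dense_in_real[of x "x + 1"] by (auto simp: R_def)
  have R_cnt: "countable (R x)" for x
    using countable_rat by (rule countable_subset[rotated]) (auto simp: R_def)
  define F where "F y x = (INF t\<in>R x. G y t)" for y x
  have bdd: "bdd_below (G y ` R x)" if "y \<in> space M" for x y
    using G_bd(1)[OF that] by (intro bdd_belowI2[of _ 0])
  have F_le: "F y x \<le> G y t" if "y \<in> space M" "t \<in> \<rat>" "x < t" for x y t
    unfolding F_def using that by (intro cINF_lower bdd) (auto simp: R_def)
  have F_ge: "c \<le> F y x" if "\<And>t. t \<in> \<rat> \<Longrightarrow> x < t \<Longrightarrow> c \<le> G y t" for x y c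
    unfolding F_def using R_ne that by (intro cINF_greatest) (auto simp: R_def)
  have F_less: "\<exists>t\<in>\<rat>. x < t \<and> G y t < c" if "F y x < c" for x y c
    using F_ge[of x c y] that by (meson not_le)
  have F_mono: "F y x \<le> F y x'" if "y \<in> space M" "x \<le> x'" for x x' y
    by (rule F_ge) (use F_le that in auto)
  have F_right: "continuous (at_right x) (F y)" if y: "y \<in> space M" for x y
    unfolding continuous_within
  proof (rule order_tendstoI)
    fix c assume "c < F y x"
    then show "\<forall>\<^sub>F z in at_right x. c < F y z"
      using F_mono[OF y] by (auto simp: eventually_at_filter intro!: always_eventually intro: less_le_trans)
  next
    fix c assume "F y x < c"
    then obtain t where t: "t \<in> \<rat>" "x < t" "G y t < c" using F_less by blast
    show "\<forall>\<^sub>F z in at_right x. F y z < c"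
      unfolding eventually_at_right_field
      using t F_le[OF y t(1)] by (intro exI[of _ t]) (auto intro: le_less_trans)
  qed
  have F0: "F y x = 0" if "y \<in> space M" "x < 0" for x y
  proof (rule antisym)
    obtain t where "t \<in> \<rat>" "x < t" "t < 0" using Rats_dense_in_real \<open>x < 0\<close> by blast
    then show "F y x \<le> 0" using F_le[of y t x] G0[of y t] that by simp
    show "0 \<le> F y x" by (rule F_ge) (use G_bd that in auto)
  qed
  have F1: "F y x = 1" if "y \<in> space M" "1 \<le> x" for x y
  proof (rule antisym)
    obtain t where "t \<in> \<rat>" "x < t" using R_ne by (auto simp: R_def)
    then show "F y x \<le> 1" using F_le[of y t x] G_bd(2)[of y t] that by simp
    show "1 \<le> F y x" by (rule F_ge) (use G1 that in auto)
  qed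
  have F_bot: "(F y \<longlongrightarrow> 0) at_bot" if "y \<in> space M" for y
    by (rule tendsto_eventually) (use F0[OF that] in \<open>auto simp: eventually_at_bot_dense\<close>)
  have F_top: "(F y \<longlongrightarrow> 1) at_top" if "y \<in> space M" for y
    by (rule tendsto_eventually) (use F1[OF that] in \<open>auto simp: eventually_at_top_linorder\<close>)
  define K where "K y = interval_measure (F y)" for y
  have rdK: "real_distribution (K y)" if y: "y \<in> space M" for y
    unfolding K_def
    by (intro real_distribution_interval_measure F_mono F_right F_bot F_top y)
  have cdfK: "emeasure (K y) {..x} = F y x" "measure (K y) {..x} = F y x" if y: "y \<in> space M" for y x
    unfolding K_def
    by (rule emeasure_interval_measure_Iic measure_interval_measure_Iic;
        intro F_mono F_right F_bot y; assumption)+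
  have [measurable]: "(\<lambda>y. F y x) \<in> borel_measurable M" for x
    unfolding F_def by (intro borel_measurable_cINF_real R_cnt) measurable
  have "K \<in> M \<rightarrow>\<^sub>M prob_algebra borel"
  proof (rule measurable_prob_algebraI)
    show pK: "prob_space (K y)" if "y \<in> space M" for y
      using rdK[OF that] by (simp add: real_distribution_def)
    show "K \<in> M \<rightarrow>\<^sub>M subprob_algebra borel"
    proof (rule measurable_subprob_algebra_generated)
      show "sets borel = sigma_sets UNIV (range (\<lambda>x::real. {..x}))"
        unfolding borel_eq_atMost by (rule sets_measure_of) auto
      show "Int_stable (range (\<lambda>x::real. {..x}))"
        by (auto simp: Int_stable_def)
      show "subprob_space (K y)" if "y \<in> space M" for y
        using pK[OF that] by (rule prob_space_imp_subprob_space)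
      show "sets (K y) = sets borel" if "y \<in> space M" for y
        using rdK[OF that] by (rule real_distribution.events_eq_borel)
      show "(\<lambda>y. emeasure (K y) A) \<in> borel_measurable M" if "A \<in> range (\<lambda>x::real. {..x})" for A
        using that cdfK(1) by (auto cong: measurable_cong)
      show "(\<lambda>y. emeasure (K y) UNIV) \<in> borel_measurable M"
      proof (subst measurable_cong[where g="\<lambda>y. 1"])
        fix y assume y: "y \<in> space M"
        show "emeasure (K y) UNIV = 1"
          using prob_space.emeasure_space_1[OF pK[OF y]] real_distribution.space_eq_univ[OF rdK[OF y]] by simp
      qed simp
    qed auto
  qed
  \<comment> \<open>\<open>K y\<close> is built from \<open>m\<close> alone. Allowing any
    \<open>s\<close> that is asymptotically equal to it at the rationals lets a single kernel be the
    limit of sequences taken from different convex sets.\<close>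
  moreover have "weak_conv_m s (K y)"
    if y: "y \<in> space M" and conv: "\<And>t. t \<in> \<rat> \<Longrightarrow> convergent (\<lambda>n. cdf (m n y) t)"
      and s: "\<And>n. real_distribution (s n)"
      and close: "\<And>t. t \<in> \<rat> \<Longrightarrow> (\<lambda>n. cdf (s n) t - cdf (m n y) t) \<longlonglongrightarrow> 0" for y s
    unfolding weak_conv_m_def weak_conv_def
  proof (intro allI impI)
    fix x assume x: "isCont (cdf (K y)) x"
    have cdf_eq: "cdf (K y) = F y"
      using cdfK(2)[OF y] by (auto simp: cdf_def)
    have s_lim: "(\<lambda>n. cdf (s n) t) \<longlonglongrightarrow> G y t" if "t \<in> \<rat>" for t
      using tendsto_add[OF close[OF that] G_lim[OF y, unfolded H_def, OF conv[OF that]]] by simp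
    have s_mono: "cdf (s n) a \<le> cdf (s n) b" if "a \<le> b" for n a b
      using finite_borel_measure.cdf_nondecreasing[OF real_distribution.finite_borel_measure_M[OF s] that] .
    show "(\<lambda>n. cdf (s n) x) \<longlonglongrightarrow> cdf (K y) x"
      unfolding cdf_eq
    proof (rule order_tendstoI)
      fix c assume "F y x < c"
      then obtain t where t: "t \<in> \<rat>" "x < t" "G y t < c" using F_less by blast
      have "\<forall>\<^sub>F n in sequentially. cdf (s n) t < c"
        using s_lim[OF t(1)] t(3) by (rule order_tendstoD)
      then show "\<forall>\<^sub>F n in sequentially. cdf (s n) x < c"
        by eventually_elim (use s_mono[of x t] t(2) in \<open>auto intro: le_less_trans\<close>)
    next
      fix c assume c: "c < F y x"
      have "(F y \<longlongrightarrow> F y x) (at_left x)"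
        using x unfolding cdf_eq isCont_def by (rule filterlim_at_split[THEN iffD1, THEN conjunct1])
      then have "\<forall>\<^sub>F z in at_left x. c < F y z" using c by (rule order_tendstoD)
      then obtain b where b: "b < x" "\<And>z. b < z \<Longrightarrow> z < x \<Longrightarrow> c < F y z"
        unfolding eventually_at_left_field by blast
      \<comment> \<open>Convergence is known at rationals only, with limit \<open>G\<close> instead
        of \<open>F\<close>. A rational \<open>t\<close> strictly between \<open>z\<close> and
        \<open>x\<close> links them: \<open>F y z\<close> is at most \<open>G y t\<close>, and
        monotonicity carries the bound from \<open>t\<close> to \<open>x\<close>.\<close>
      define z where "z = (b + x) / 2"
      have z: "z < x" "c < F y z" using b by (auto simp: z_def)
      obtain t where t: "t \<in> \<rat>" "z < t" "t < x" using Rats_dense_in_real z(1) by blast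
      have "c < G y t" using z F_le[OF y t(1,2)] by simp
      with s_lim[OF t(1)] have "\<forall>\<^sub>F n in sequentially. c < cdf (s n) t" by (rule order_tendstoD)
      then show "\<forall>\<^sub>F n in sequentially. c < cdf (s n) x"
        by eventually_elim (use s_mono[of t x] t(3) in \<open>auto intro: less_le_trans\<close>)
    qed
  qed
  ultimately show ?thesis using that by blast
qed

section \<open>Convex families in a space of square integrable functions\<close>

lemma (in prob_space) integrable_of_bounded:
  assumes "f \<in> borel_measurable M" "\<And>x. x \<in> space M \<Longrightarrow> \<bar>f x\<bar> \<le> (b::real)"
  shows "integrable M f"
  using assms by (intro integrable_const_bound[of _ b]) auto

text \<open>Nonnegativity of the variance bounds the first absolute moments by
  \<open>sqrt C * (1/2) ^ n\<close>, so the sum of the absolute values has finite expectation and is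
  finite almost surely. The rate 1/4 is chosen to remain geometric after the square root.\<close>

lemma (in prob_space) AE_summable_of_second_moments:
  fixes h :: "nat \<Rightarrow> 'a \<Rightarrow> real"
  assumes [measurable]: "\<And>n. h n \<in> borel_measurable M"
    and bd: "\<And>n x. x \<in> space M \<Longrightarrow> \<bar>h n x\<bar> \<le> b"
    and small: "\<And>n. (\<integral>x. (h n x)\<^sup>2 \<partial>M) \<le> C * (1/4) ^ n"
  shows "AE x in M. summable (\<lambda>n. h n x)"
proof -
  have b0: "0 \<le> b"
    using not_empty bd[of _ 0] abs_ge_zero order.trans by blast
  have int: "integrable M (h n)" "integrable M (\<lambda>x. (h n x)\<^sup>2)" for n
  proof -
    show "integrable M (h n)" using bd by (intro integrable_of_bounded[of _ b]) auto
    show "integrable M (\<lambda>x. (h n x)\<^sup>2)"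
    proof (intro integrable_of_bounded[of _ "b\<^sup>2"])
      show "\<bar>(h n x)\<^sup>2\<bar> \<le> b\<^sup>2" if "x \<in> space M" for x
        using power_mono[OF bd[OF that, of n], of 2] by simp
    qed simp
  qed
  have C: "0 \<le> C"
    using small[of 0] Bochner_Integration.integral_nonneg[of M "\<lambda>x. (h 0 x)\<^sup>2"] by (simp del: Bochner_Integration.integral_nonneg)
  have l1: "(\<integral>x. \<bar>h n x\<bar> \<partial>M) \<le> sqrt C * (1/2) ^ n" for n
  proof -
    have "(\<integral>x. \<bar>h n x\<bar> \<partial>M)\<^sup>2 \<le> (\<integral>x. \<bar>h n x\<bar>\<^sup>2 \<partial>M)"
    proof -
      have "0 \<le> (\<integral>x. (\<bar>h n x\<bar> - expectation (\<lambda>x. \<bar>h n x\<bar>))\<^sup>2 \<partial>M)" by simp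
      also have "\<dots> = (\<integral>x. \<bar>h n x\<bar>\<^sup>2 \<partial>M) - (\<integral>x. \<bar>h n x\<bar> \<partial>M)\<^sup>2"
        using int[of n] by (intro variance_eq) auto
      finally show ?thesis by simp
    qed
    also have "\<dots> \<le> C * (1/4) ^ n" using small[of n] by simp
    also have "\<dots> = (sqrt C * (1/2) ^ n)\<^sup>2"
      using C by (simp add: power_mult_distrib power_mult[symmetric] mult.commute[of _ 2])
        (simp add: power_mult power2_eq_square)
    finally show ?thesis
      by (rule power2_le_imp_le) (use C in simp)
  qed
  have "(\<integral>\<^sup>+x. (\<Sum>n. ennreal \<bar>h n x\<bar>) \<partial>M) = (\<Sum>n. \<integral>\<^sup>+x. ennreal \<bar>h n x\<bar> \<partial>M)"
    by (rule nn_integral_suminf) simp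
  also have "\<dots> = (\<Sum>n. ennreal (\<integral>x. \<bar>h n x\<bar> \<partial>M))"
    using int by (subst nn_integral_eq_integral) auto
  also have "\<dots> \<le> (\<Sum>n. ennreal (sqrt C * (1/2) ^ n))"
    using l1 by (intro suminf_le ennreal_leI summableI)
  also have "\<dots> = ennreal (\<Sum>n. sqrt C * (1/2) ^ n)"
    using C by (intro suminf_ennreal2 summable_mult summable_geometric) auto
  also have "\<dots> < \<infinity>" by simp
  finally have "AE x in M. (\<Sum>n. ennreal \<bar>h n x\<bar>) \<noteq> \<infinity>"
    by (intro nn_integral_noteq_infinite) auto
  then show ?thesis
  proof eventually_elim
    case (elim x)
    then have "summable (\<lambda>n. \<bar>h n x\<bar>)"
      by (intro summable_suminf_not_top) (auto simp: infinity_ennreal_def)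
    then show ?case by (rule summable_rabs_cancel)
  qed
qed

text \<open>Elements of almost minimal norm in a convex set are close to each other, by the
  parallelogram law; this replaces weak compactness of bounded sets in \<open>L\<^sup>2\<close>.\<close>
lemma (in prob_space) convex_family_cluster:
  fixes g :: "'k \<Rightarrow> 'a \<Rightarrow> real"
  assumes ne: "\<K> \<noteq> {}" and neK: "\<And>K. K \<in> \<K> \<Longrightarrow> K \<noteq> {}"
    and Int: "\<And>K L. K \<in> \<K> \<Longrightarrow> L \<in> \<K> \<Longrightarrow> K \<inter> L \<in> \<K>"
    and g[measurable]: "\<And>k. k \<in> \<Union>\<K> \<Longrightarrow> g k \<in> borel_measurable M"
    and g01: "\<And>k x. k \<in> \<Union>\<K> \<Longrightarrow> x \<in> space M \<Longrightarrow> 0 \<le> g k x \<and> g k x \<le> 1"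
    and mid: "\<And>K a b. K \<in> \<K> \<Longrightarrow> a \<in> K \<Longrightarrow> b \<in> K \<Longrightarrow>
      \<exists>c\<in>K. \<forall>x\<in>space M. g c x = (g a x + g b x) / 2"
  obtains s0 where "\<And>n. s0 n \<in> \<Union>\<K>" "AE x in M. convergent (\<lambda>n. g (s0 n) x)"
    "\<And>K. K \<in> \<K> \<Longrightarrow> \<exists>s. (\<forall>n. s n \<in> K) \<and> (AE x in M. (\<lambda>n. g (s n) x - g (s0 n) x) \<longlonglongrightarrow> 0)"
proof -
  define \<Phi> where "\<Phi> k = (\<integral>x. (g k x)\<^sup>2 \<partial>M)" for k
  \<comment> \<open>The tolerances decrease at the rate demanded by
    \<open>AE_summable_of_second_moments\<close>, so that closeness in mean square becomes almost
    sure convergence without passing to subsequences.\<close>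
  define e where "e n = (1/4::real) ^ n" for n
  have e_pos: "e n > 0" for n by (simp add: e_def)
  have int: "integrable M (\<lambda>x. g k x * g l x)" if "k \<in> \<Union>\<K>" "l \<in> \<Union>\<K>" for k l
  proof (intro integrable_of_bounded[of _ 1])
    show "(\<lambda>x. g k x * g l x) \<in> borel_measurable M" using that by measurable
    show "\<bar>g k x * g l x\<bar> \<le> 1" if "x \<in> space M" for x
      using g01[of k x] g01[of l x] that \<open>k \<in> \<Union>\<K>\<close> \<open>l \<in> \<Union>\<K>\<close> by (auto simp: abs_mult intro!: mult_le_one)
  qed
  have \<Phi>_bd: "0 \<le> \<Phi> k" "\<Phi> k \<le> 1" if "k \<in> \<Union>\<K>" for k
  proof -
    show "0 \<le> \<Phi> k" unfolding \<Phi>_def by simp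
    have "\<Phi> k \<le> (\<integral>x. 1 \<partial>M)"
      unfolding \<Phi>_def using int[OF that that] g01[OF that]
      by (intro integral_mono) (auto simp: power2_eq_square intro!: mult_le_one)
    then show "\<Phi> k \<le> 1" by (simp add: prob_space)
  qed
  define i where "i K = (INF k\<in>K. \<Phi> k)" for K
  \<comment> \<open>Smaller sets have larger infima \<open>i K\<close>, all at most 1. Thus
    \<open>a\<close> is the limit of the minimal squared norm along the directed family, and the
    chain \<open>N\<close> below comes within \<open>e n\<close> of it.\<close>
  define a where "a = (SUP K\<in>\<K>. i K)"
  have \<Phi>_bdd: "bdd_below (\<Phi> ` K)" if "K \<in> \<K>" for K
    using that \<Phi>_bd by (intro bdd_belowI2[of _ 0]) auto
  have i_le: "i K \<le> \<Phi> k" if "K \<in> \<K>" "k \<in> K" for K k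
    unfolding i_def using that \<Phi>_bd by (intro cINF_lower bdd_belowI2[of _ 0]) auto
  have i_bdd: "bdd_above (i ` \<K>)"
  proof (rule bdd_aboveI2)
    fix K assume K: "K \<in> \<K>"
    then obtain k where "k \<in> K" using neK by blast
    then show "i K \<le> 1" using i_le[OF K] \<Phi>_bd(2)[of k] K by force
  qed
  have i_a: "i K \<le> a" if "K \<in> \<K>" for K
    unfolding a_def using that i_bdd by (intro cSUP_upper)
  have i_mono: "i L \<le> i K" if "K \<in> \<K>" "L \<in> \<K>" "K \<subseteq> L" for K L
    unfolding i_def using that neK[OF that(1)] \<Phi>_bd
    by (intro cINF_superset_mono bdd_belowI2[of _ 0]) auto
  have "\<exists>K\<in>\<K>. a - e n < i K" for n
    unfolding a_def using e_pos[of n] ne i_bdd by (intro less_cSUP_iff[THEN iffD1]) auto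
  then obtain L where L: "\<And>n. L n \<in> \<K>" "\<And>n. a - e n < i (L n)" by metis
  define N where "N n = (\<Inter>j\<le>n. L j)" for n
  have N: "N n \<in> \<K>" for n
    unfolding N_def by (induction n) (auto simp: atMost_Suc L Int)
  have N_sub: "N (Suc n) \<subseteq> N n" and N_L: "N n \<subseteq> L n" for n
    by (auto simp: N_def)
  have pick: "\<exists>k\<in>K \<inter> N n. \<Phi> k < a + e n" if "K \<in> \<K>" for K n
  \<comment> \<open>Intersecting with \<open>K\<close> stays inside the family, so the infimum over
    \<open>K \<inter> N n\<close> still does not exceed \<open>a\<close>. Near minimisers of the
    chain can thus be found inside any prescribed \<open>K\<close>.\<close>
  proof -
    have KN: "K \<inter> N n \<in> \<K>" using that N by (rule Int)
    then have "i (K \<inter> N n) < a + e n" using i_a[OF KN] e_pos[of n] by linarith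
    then show ?thesis
      unfolding i_def using cINF_less_iff[OF neK[OF KN] \<Phi>_bdd[OF KN]] by blast
  qed
  \<comment> \<open>The midpoint \<open>c\<close> lies in \<open>N n\<close>, hence has squared norm
    above \<open>a - e n\<close>. The parallelogram law then gives less than
    \<open>4 * (a + e n) - 4 * (a - e n)\<close>, which is the bound \<open>8 * e n\<close>.\<close>
  have close: "(\<integral>x. (g k x - g l x)\<^sup>2 \<partial>M) \<le> 8 * e n"
    if k: "k \<in> N n" "\<Phi> k < a + e n" and l: "l \<in> N n" "\<Phi> l < a + e n" for k l n
  proof -
    have kl: "k \<in> \<Union>\<K>" "l \<in> \<Union>\<K>" using k l N by auto
    obtain c where c: "c \<in> N n" "\<And>x. x \<in> space M \<Longrightarrow> g c x = (g k x + g l x) / 2"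
      using mid[OF N k(1) l(1)] by blast
    have cm: "c \<in> \<Union>\<K>" using c(1) N by blast
    have "a - e n < \<Phi> c"
      using L(2)[of n] i_mono[OF N L(1) N_L, of n] i_le[OF N c(1)] by linarith
    moreover have "(\<integral>x. (g k x - g l x)\<^sup>2 \<partial>M) = (\<integral>x. 2 * (g k x * g k x) + 2 * (g l x * g l x) - 4 * (g c x * g c x) \<partial>M)"
      by (intro Bochner_Integration.integral_cong) (auto simp: c(2) power2_eq_square field_simps)
    moreover have "\<dots> = 2 * \<Phi> k + 2 * \<Phi> l - 4 * \<Phi> c"
      unfolding \<Phi>_def power2_eq_square
      using int[OF kl(1) kl(1)] int[OF kl(2) kl(2)] int[OF cm cm] by simp
    ultimately show ?thesis using k(2) l(2) by linarith
  qed
  obtain s0 where s0: "\<And>n. s0 n \<in> N n" "\<And>n. \<Phi> (s0 n) < a + e n"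
    using pick[OF N] by (metis IntD2)
  have s0_mem: "s0 n \<in> \<Union>\<K>" for n using s0(1) N by blast
  have e_Suc: "e (Suc n) \<le> e n" for n by (simp add: e_def)
  have diff_bd: "\<bar>g k x - g l x\<bar> \<le> 1" if "k \<in> \<Union>\<K>" "l \<in> \<Union>\<K>" "x \<in> space M" for k l x
    using g01[of k x] g01[of l x] that by auto
  have "AE x in M. convergent (\<lambda>n. g (s0 n) x)"
  proof -
    have "AE x in M. summable (\<lambda>n. g (s0 (Suc n)) x - g (s0 n) x)"
    proof (rule AE_summable_of_second_moments[where b=1])
      show "(\<integral>x. (g (s0 (Suc n)) x - g (s0 n) x)\<^sup>2 \<partial>M) \<le> 8 * (1/4) ^ n" for n
        unfolding e_def[symmetric]
        using s0[of "Suc n"] s0[of n] N_sub[of n] e_Suc[of n] by (intro close) auto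
    qed (use s0_mem diff_bd in \<open>auto simp del: Union_iff intro!: borel_measurable_diff g\<close>)
    then show ?thesis
    proof eventually_elim
      case (elim x)
      then have "(\<lambda>n. g (s0 0) x + (\<Sum>j<n. g (s0 (Suc j)) x - g (s0 j) x))
          \<longlonglongrightarrow> g (s0 0) x + (\<Sum>j. g (s0 (Suc j)) x - g (s0 j) x)"
        by (intro tendsto_intros summable_LIMSEQ)
      also have "(\<lambda>n. g (s0 0) x + (\<Sum>j<n. g (s0 (Suc j)) x - g (s0 j) x)) = (\<lambda>n. g (s0 n) x)"
        by (simp add: sum_lessThan_telescope[of "\<lambda>n. g (s0 n) x"])
      finally show ?case by (auto simp: convergent_def)
    qed
  qed
  \<comment> \<open>The elements \<open>s n\<close> and \<open>s0 n\<close> are both near minimal in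
    the same \<open>N n\<close>, so \<open>close\<close> compares them although \<open>K\<close>
    itself does not occur in the chain.\<close>
  moreover have "\<exists>s. (\<forall>n. s n \<in> K) \<and> (AE x in M. (\<lambda>n. g (s n) x - g (s0 n) x) \<longlonglongrightarrow> 0)" if K: "K \<in> \<K>" for K
  proof -
    obtain s where s: "\<And>n. s n \<in> K \<inter> N n" "\<And>n. \<Phi> (s n) < a + e n"
      using pick[OF K] by metis
    have s_mem: "s n \<in> \<Union>\<K>" for n using s(1) K by blast
    have "AE x in M. summable (\<lambda>n. g (s n) x - g (s0 n) x)"
    proof (rule AE_summable_of_second_moments[where b=1])
      show "(\<integral>x. (g (s n) x - g (s0 n) x)\<^sup>2 \<partial>M) \<le> 8 * (1/4) ^ n" for n
        unfolding e_def[symmetric] using s[of n] s0[of n] by (intro close) auto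
    qed (use s_mem s0_mem diff_bd in \<open>auto simp del: Union_iff intro!: borel_measurable_diff g\<close>)
    then have "AE x in M. (\<lambda>n. g (s n) x - g (s0 n) x) \<longlonglongrightarrow> 0"
      by eventually_elim (rule summable_LIMSEQ_zero)
    then show ?thesis using s(1) by blast
  qed
  ultimately show ?thesis using that s0_mem by blast
qed

section \<open>Convex compactness of stochastic kernels\<close>

lemma kernel_prob_space:
  assumes "\<gamma> \<in> kernels Y U" "y \<in> Y"
  shows "prob_space (\<gamma> y)" "sets (\<gamma> y) = sets (bsp U)" "space (\<gamma> y) = U"
proof -
  have "\<gamma> y \<in> space (prob_algebra (bsp U))"
    using assms measurable_space[of \<gamma> "bsp Y" "prob_algebra (bsp U)" y] by (auto simp: kernels_def space_restrict_space)
  then show "prob_space (\<gamma> y)" and s: "sets (\<gamma> y) = sets (bsp U)"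
    by (auto simp: space_prob_algebra)
  show "space (\<gamma> y) = U"
    using sets_eq_imp_space_eq[OF s] by (simp add: space_restrict_space)
qed

text \<open>For compact \<open>U\<close> every test function is bounded on \<open>U\<close>, so this
  is ordinary weak convergence of laws on \<open>U\<close>. Test functions are continuous on
  \<open>U\<close> only, because sections of the cost are continuous only on the action
  sets.\<close>

definition weakly_to :: "'u::topological_space set \<Rightarrow> (nat \<Rightarrow> 'u measure) \<Rightarrow> 'u measure \<Rightarrow> bool" where
  "weakly_to U m l \<longleftrightarrow> (\<forall>\<phi> :: 'u \<Rightarrow> real. continuous_on U \<phi> \<longrightarrow>
     (\<lambda>n. \<integral>u. \<phi> u \<partial>m n) \<longlonglongrightarrow> (\<integral>u. \<phi> u \<partial>l))"

text \<open>All coded laws live on the closed set \<open>C\<close>, and so does their weak limit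
  \<open>k\<close>; the default \<open>u0\<close> is therefore used on a null set and merely keeps
  the decoder inside \<open>U\<close>. On \<open>C\<close> the function
  \<open>\<phi> \<circ> q\<close> is bounded and continuous, and Tietze extends it to the line,
  where it can be tested against weak convergence of real laws.\<close>

lemma weak_limit_decode:
  fixes r :: "'u::polish_space \<Rightarrow> real" and m :: "nat \<Rightarrow> 'u measure"
  assumes U: "compact U" "u0 \<in> U"
    and r: "r \<in> borel_measurable borel" and C: "closed C" "r ` U \<subseteq> C"
    and q: "continuous_on C q" "q ` C \<subseteq> U" "\<And>u. u \<in> U \<Longrightarrow> q (r u) = u"
    and m: "\<And>n. prob_space (m n)" "\<And>n. sets (m n) = sets (bsp U)"
    and k: "real_distribution k" "weak_conv_m (\<lambda>n. distr (m n) borel r) k"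
  shows "weakly_to U m (distr k (bsp U) (\<lambda>x. if x \<in> C then q x else u0))"
  unfolding weakly_to_def
proof (intro allI impI)
  interpret k: real_distribution k by fact
  note [measurable_cong] = m(2)
  have [measurable]: "r \<in> borel_measurable (bsp U)"
    using r by (rule measurable_restrict_space1)
  have sp: "space (m n) = U" for n
    using sets_eq_imp_space_eq[OF m(2)[of n]] by (simp add: space_restrict_space)
  have rd: "real_distribution (distr (m n) borel r)" for n
    by (rule prob_space.real_distribution_distr[OF m(1)]) measurable
  have conv: "(\<lambda>n. \<integral>u. h (r u) \<partial>m n) \<longlonglongrightarrow> (\<integral>x. h x \<partial>k)"
    if h: "continuous_on UNIV h" "\<And>x. \<bar>h x\<bar> \<le> B" for h :: "real \<Rightarrow> real" and B
  proof -
    have [measurable]: "h \<in> borel_measurable borel" using h(1) by (rule borel_measurable_continuous_onI)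
    have "(\<lambda>n. \<integral>x. h x \<partial>distr (m n) borel r) \<longlonglongrightarrow> (\<integral>x. h x \<partial>k)"
      using h by (intro weak_conv_imp_integral_bdd_continuous_conv[OF rd k, of h B])
        (auto simp: continuous_on_eq_continuous_at)
    then show ?thesis by (subst (asm) integral_distr) measurable
  qed
  have "C \<noteq> {}" using U(2) C(2) by auto
  \<comment> \<open>A bounded continuous function that vanishes exactly on \<open>C\<close>. Its
    integral is 0 along the sequence, hence also under \<open>k\<close>, which confines
    \<open>k\<close> to \<open>C\<close>.\<close>
  define d where "d x = min 1 (infdist x C)" for x
  have d_cont: "continuous_on UNIV d" unfolding d_def by (intro continuous_intros)
  have d_bd: "0 \<le> d x" "d x \<le> 1" for x by (auto simp: d_def infdist_nonneg)
  have [measurable]: "d \<in> borel_measurable borel" using d_cont by (rule borel_measurable_continuous_onI)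
  have "(\<integral>u. d (r u) \<partial>m n) = 0" for n
    using C(2) by (intro integral_eq_zero_AE AE_I2) (auto simp: d_def sp image_subset_iff)
  then have "(\<integral>x. d x \<partial>k) = 0"
    using conv[OF d_cont, of 1] d_bd by (auto simp: LIMSEQ_const_iff)
  moreover have "integrable k d"
    using d_bd by (intro k.integrable_of_bounded[of _ 1]) auto
  ultimately have "AE x in k. d x = 0"
    using d_bd by (subst (asm) integral_nonneg_eq_0_iff_AE) auto
  then have AE_C: "AE x in k. x \<in> C"
    by eventually_elim (use C(1) \<open>C \<noteq> {}\<close> in \<open>auto simp: d_def min_def in_closed_iff_infdist_zero split: if_splits\<close>)
  have [measurable]: "C \<in> sets borel" using C(1) by simp
  have q': "(\<lambda>x. if x \<in> C then q x else u0) \<in> borel \<rightarrow>\<^sub>M bsp U" (is "?q \<in> _")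
  proof (rule measurable_restrict_space2)
    show "?q \<in> space borel \<rightarrow> U" using q(2) U(2) by (auto simp: image_subset_iff)
    show "?q \<in> borel \<rightarrow>\<^sub>M borel"
      by (intro borel_measurable_continuous_on_if q continuous_on_const) simp
  qed
  fix \<phi> :: "'u \<Rightarrow> real" assume \<phi>: "continuous_on U \<phi>"
  have [measurable]: "\<phi> \<in> borel_measurable (bsp U)"
    using \<phi> by (rule borel_measurable_continuous_on_restrict)
  have "bounded (\<phi> ` U)" using U(1) \<phi> by (intro compact_imp_bounded compact_continuous_image)
  then obtain B where B: "\<And>u. u \<in> U \<Longrightarrow> \<bar>\<phi> u\<bar> \<le> B" by (auto simp: bounded_iff)
  have B0: "0 \<le> B" using B[OF U(2)] by linarith
  have "continuous_on C (\<lambda>x. \<phi> (q x))"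
    using q(2) by (intro continuous_on_compose2[OF \<phi> q(1)])
  then obtain h where h: "continuous_on UNIV h" "\<And>x. x \<in> C \<Longrightarrow> h x = \<phi> (q x)" "\<And>x. norm (h x) \<le> B"
    by (rule Tietze[where U=UNIV and B=B]) (use C(1) B q(2) B0 in \<open>auto simp: image_subset_iff\<close>)
  have "(\<lambda>n. \<integral>u. h (r u) \<partial>m n) \<longlonglongrightarrow> (\<integral>x. h x \<partial>k)"
    using h by (intro conv[of h B]) auto
  moreover have "(\<integral>u. h (r u) \<partial>m n) = (\<integral>u. \<phi> u \<partial>m n)" for n
    using C(2) q(3) by (intro Bochner_Integration.integral_cong) (auto simp: sp h(2) image_subset_iff)
  moreover have "(\<integral>x. h x \<partial>k) = (\<integral>x. \<phi> (?q x) \<partial>k)"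
  proof (rule integral_cong_AE)
    show "h \<in> borel_measurable k"
      using borel_measurable_continuous_onI[OF h(1)] by simp
    show "(\<lambda>x. \<phi> (?q x)) \<in> borel_measurable k"
      using measurable_compose[OF q' \<open>\<phi> \<in> borel_measurable (bsp U)\<close>] by simp
    show "AE x in k. h x = \<phi> (?q x)" using AE_C by eventually_elim (simp add: h(2))
  qed
  moreover have "\<dots> = (\<integral>u. \<phi> u \<partial>distr k (bsp U) ?q)"
    using q' by (intro integral_distr[symmetric]) auto
  ultimately show "(\<lambda>n. \<integral>u. \<phi> u \<partial>m n) \<longlonglongrightarrow> (\<integral>u. \<phi> u \<partial>distr k (bsp U) ?q)" by simp
qed

text \<open>The sets \<open>K\<close> are not assumed closed, so \<open>\<gamma>\<close> is claimed
  only as a limit from inside each of them. Convexity enters as closure under midpoints, expressed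
  setwise on measures so that it transfers to distribution functions of the coded laws.\<close>

theorem kernel_convex_compactness:
  fixes Y :: "'y::topological_space set" and U :: "'u::polish_space set"
  assumes U: "compact U" and Q: "prob_space Q" "sets Q = sets (bsp Y)"
    and ne: "\<K> \<noteq> {}" and neK: "\<And>K. K \<in> \<K> \<Longrightarrow> K \<noteq> {}"
    and Int: "\<And>K L. K \<in> \<K> \<Longrightarrow> L \<in> \<K> \<Longrightarrow> K \<inter> L \<in> \<K>"
    and sub: "\<And>K. K \<in> \<K> \<Longrightarrow> K \<subseteq> kernels Y U"
    and mid: "\<And>K a b. K \<in> \<K> \<Longrightarrow> a \<in> K \<Longrightarrow> b \<in> K \<Longrightarrow>
      \<exists>c\<in>K. \<forall>y\<in>Y. \<forall>E\<in>sets (bsp U). measure (c y) E = (measure (a y) E + measure (b y) E) / 2"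
  obtains \<gamma> where "\<gamma> \<in> kernels Y U"
    "\<And>K. K \<in> \<K> \<Longrightarrow> \<exists>s. (\<forall>n. s n \<in> K) \<and> (AE y in Q. weakly_to U (\<lambda>n. s n y) (\<gamma> y))"
proof -
  obtain r :: "'u \<Rightarrow> real" and C q where
    r: "r \<in> borel_measurable borel" "\<And>u. 0 \<le> r u \<and> r u \<le> 1" and C: "closed C" "r ` U \<subseteq> C"
    and q: "continuous_on C q" "q ` C \<subseteq> U" "\<And>u. u \<in> U \<Longrightarrow> q (r u) = u"
    using compact_real_code[OF U] by metis
  interpret Q: prob_space Q by fact
  have spQ: "space Q = Y" using sets_eq_imp_space_eq[OF Q(2)] by (simp add: space_restrict_space)
  note [measurable_cong] = Q(2)
  have rU[measurable]: "r \<in> borel_measurable (bsp U)"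
    using r(1) by (rule measurable_restrict_space1)
  obtain \<gamma>0 where \<gamma>0: "\<gamma>0 \<in> kernels Y U" using ne neK sub by blast
  obtain y0 where y0: "y0 \<in> Y" using Q.not_empty spQ by blast
  have "U \<noteq> {}"
    using kernel_prob_space[OF \<gamma>0 y0] prob_space.not_empty by metis
  then obtain u0 where u0: "u0 \<in> U" by blast
  txt \<open>The weights \<open>P\<close> let a single \<open>L\<^sup>2\<close> norm control the distribution functions at all rationals.\<close>
  define P :: "nat measure" where "P = measure_pmf (geometric_pmf (1/2))"
  interpret P: prob_space P unfolding P_def by (rule prob_space_measure_pmf)
  interpret QP: pair_prob_space Q P ..
  define t where "t = from_nat_into (\<rat> :: real set)"
  have t: "t j \<in> \<rat>" for j
    unfolding t_def by (rule from_nat_into) auto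
  have t_surj: "\<exists>j. x = t j" if "x \<in> \<rat>" for x
    using from_nat_into_surj[OF countable_rat that] unfolding t_def by metis
  define D where "D a y = distr (a y) borel r" for a :: "'y \<Rightarrow> 'u measure" and y
  define E where "E x = {u \<in> U. r u \<le> x}" for x
  have E_sets[measurable]: "E x \<in> sets (bsp U)" for x
  proof -
    have "{u \<in> space (bsp U). r u \<le> x} \<in> sets (bsp U)" by measurable
    then show ?thesis by (simp add: E_def space_restrict_space)
  qed
  have D_prob: "real_distribution (D a y)" if "a \<in> kernels Y U" "y \<in> Y" for a y
    unfolding D_def using kernel_prob_space[OF that] rU
    by (intro prob_space.real_distribution_distr) (auto cong: measurable_cong_sets)
  have D_cdf: "cdf (D a y) x = measure (a y) (E x)" if "a \<in> kernels Y U" "y \<in> Y" for a y x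
    unfolding cdf_def D_def using kernel_prob_space[OF that] rU
    by (subst measure_distr) (auto simp: E_def vimage_def Int_def conj_commute cong: measurable_cong_sets)
  \<comment> \<open>By \<open>D_cdf\<close> this is the distribution function of the coded law at
    the rational \<open>t j\<close>. Writing it through \<open>measure (a y)\<close> makes the
    midpoint hypothesis apply directly.\<close>
  define g where "g a z = measure (a (fst z)) (E (t (snd z)))" for a :: "'y \<Rightarrow> 'u measure" and z
  have aM: "a \<in> Q \<rightarrow>\<^sub>M prob_algebra (bsp U)" if "a \<in> kernels Y U" for a
    using that Q(2) by (auto simp: kernels_def cong: measurable_cong_sets)
  have aE: "(\<lambda>y. measure (a y) (E x)) \<in> borel_measurable Q" if "a \<in> kernels Y U" for a x
    using measurable_compose[OF measurable_prob_algebraD[OF aM[OF that]] measurable_measure_subprob_algebra[OF E_sets]] .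
  obtain s0 where s0: "\<And>n. s0 n \<in> \<Union>\<K>" "AE z in Q \<Otimes>\<^sub>M P. convergent (\<lambda>n. g (s0 n) z)"
    "\<And>K. K \<in> \<K> \<Longrightarrow> \<exists>s. (\<forall>n. s n \<in> K) \<and> (AE z in Q \<Otimes>\<^sub>M P. (\<lambda>n. g (s n) z - g (s0 n) z) \<longlonglongrightarrow> 0)"
  proof (rule QP.convex_family_cluster[of \<K> g, OF ne neK Int])
    fix k assume "k \<in> \<Union>\<K>"
    then have k: "k \<in> kernels Y U" using sub by blast
    have "(\<lambda>(y, j). measure (k y) (E (t j))) \<in> borel_measurable (Q \<Otimes>\<^sub>M count_space UNIV)"
      unfolding case_prod_beta'
      by (rule measurable_compose_countable[where f="\<lambda>j z. measure (k (fst z)) (E (t j))" and g=snd])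
        (rule measurable_compose[OF measurable_fst aE[OF k]], rule measurable_snd)
    moreover have "sets (Q \<Otimes>\<^sub>M P) = sets (Q \<Otimes>\<^sub>M count_space UNIV)"
      by (intro sets_pair_measure_cong) (auto simp: P_def)
    ultimately show "g k \<in> borel_measurable (Q \<Otimes>\<^sub>M P)"
      unfolding g_def by (simp add: case_prod_beta' cong: measurable_cong_sets)
    show "0 \<le> g k z \<and> g k z \<le> 1" if "z \<in> space (Q \<Otimes>\<^sub>M P)" for z
      using prob_space.prob_le_1[OF kernel_prob_space(1)[OF k]] that
      by (auto simp: g_def space_pair_measure spQ)
  next
    fix K a b assume "K \<in> \<K>" "a \<in> K" "b \<in> K"
    then obtain c where "c \<in> K" "\<forall>y\<in>Y. \<forall>E\<in>sets (bsp U). measure (c y) E = (measure (a y) E + measure (b y) E) / 2"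
      using mid by blast
    then show "\<exists>c\<in>K. \<forall>z\<in>space (Q \<Otimes>\<^sub>M P). g c z = (g a z + g b z) / 2"
      using E_sets by (intro bexI[of _ c]) (auto simp: g_def space_pair_measure spQ)
  qed auto
  have s0_ker: "s0 n \<in> kernels Y U" for n using s0(1) sub by blast
  \<comment> \<open>Every index has positive mass under \<open>P\<close>, so almost every
    \<open>j\<close> means every \<open>j\<close> and thus every rational. The predicate
    \<open>R\<close> covers convergence of \<open>s0\<close> and asymptotic equality of
    \<open>s\<close> and \<open>s0\<close> at once.\<close>
  have fiber: "AE y in Q. \<forall>x\<in>\<rat>. R (\<lambda>n. measure (s n y) (E x)) (\<lambda>n. measure (s0 n y) (E x))"
    if "AE z in Q \<Otimes>\<^sub>M P. R (\<lambda>n. g (s n) z) (\<lambda>n. g (s0 n) z)" for R s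
  proof -
    have "AE y in Q. AE j in P. R (\<lambda>n. g (s n) (y, j)) (\<lambda>n. g (s0 n) (y, j))"
      using that by (rule QP.AE_pair)
    then show ?thesis
    proof eventually_elim
      case (elim y)
      then have "\<And>j. R (\<lambda>n. g (s n) (y, j)) (\<lambda>n. g (s0 n) (y, j))"
        unfolding P_def by (auto simp: AE_measure_pmf_iff set_pmf_geometric)
      then show ?case unfolding g_def using t_surj by fastforce
    qed
  qed
  obtain K where K: "K \<in> bsp Y \<rightarrow>\<^sub>M prob_algebra borel"
    "\<And>y s. \<lbrakk>y \<in> space (bsp Y); \<And>t. t \<in> \<rat> \<Longrightarrow> convergent (\<lambda>n. cdf (D (s0 n) y) t);
       \<And>n. real_distribution (s n);
       \<And>t. t \<in> \<rat> \<Longrightarrow> (\<lambda>n. cdf (s n) t - cdf (D (s0 n) y) t) \<longlonglongrightarrow> 0\<rbrakk> \<Longrightarrow> weak_conv_m s (K y)"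
  proof (rule limit_cdf_kernel[of "\<lambda>n. D (s0 n)" "bsp Y"])
    show "D (s0 n) \<in> bsp Y \<rightarrow>\<^sub>M prob_algebra borel" for n
      unfolding D_def using s0_ker[of n] by (intro measurable_distr_prob_space2[of _ _ "bsp U"]) (auto simp: kernels_def)
    show "measure (D (s0 n) y) {0..1} = 1" if "y \<in> space (bsp Y)" for n y
    proof -
      have y: "y \<in> Y" using that by (simp add: space_restrict_space)
      note k = kernel_prob_space[OF s0_ker[of n] y]
      have "measure (D (s0 n) y) {0..1} = measure (s0 n y) (r -` {0..1} \<inter> space (s0 n y))"
        unfolding D_def using rU k(2) by (intro measure_distr) (auto cong: measurable_cong_sets)
      also have "r -` {0..1} = UNIV" using r(2) by auto
      finally show ?thesis using prob_space.prob_space[OF k(1)] by simp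
    qed
  qed auto
  define \<gamma> where "\<gamma> y = distr (K y) (bsp U) (\<lambda>x. if x \<in> C then q x else u0)" for y
  have "\<gamma> \<in> kernels Y U"
  proof -
    have [measurable]: "C \<in> sets borel" using C(1) by simp
    have "(\<lambda>x. if x \<in> C then q x else u0) \<in> borel \<rightarrow>\<^sub>M bsp U"
      using q(2) u0
      by (intro measurable_restrict_space2 borel_measurable_continuous_on_if q continuous_on_const)
        (auto simp: image_subset_iff)
    then show ?thesis
      unfolding \<gamma>_def kernels_def using K(1) by (intro measurable_compose[OF _ measurable_distr_prob_space])
  qed
  moreover have "\<exists>s. (\<forall>n. s n \<in> L) \<and> (AE y in Q. weakly_to U (\<lambda>n. s n y) (\<gamma> y))" if L: "L \<in> \<K>" for L
  proof -
    obtain s where s: "\<And>n. s n \<in> L" "AE z in Q \<Otimes>\<^sub>M P. (\<lambda>n. g (s n) z - g (s0 n) z) \<longlonglongrightarrow> 0"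
      using s0(3)[OF L] by blast
    have s_ker: "s n \<in> kernels Y U" for n using s(1) sub L by blast
    have "AE y in Q. y \<in> space Q" by simp
    moreover have "AE y in Q. \<forall>x\<in>\<rat>. convergent (\<lambda>n. measure (s0 n y) (E x))"
      by (rule fiber[of "\<lambda>a b. convergent b", OF s0(2)])
    moreover have "AE y in Q. \<forall>x\<in>\<rat>. (\<lambda>n. measure (s n y) (E x) - measure (s0 n y) (E x)) \<longlonglongrightarrow> 0"
      by (rule fiber[of "\<lambda>a b. (\<lambda>n. a n - b n) \<longlonglongrightarrow> 0", OF s(2)])
    ultimately have "AE y in Q. weakly_to U (\<lambda>n. s n y) (\<gamma> y)"
    proof eventually_elim
      case (elim y)
      then have y: "y \<in> Y" by (simp add: spQ)
      have "weak_conv_m (\<lambda>n. D (s n) y) (K y)"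
        using elim y D_prob[OF s_ker y] by (intro K(2)) (auto simp: D_cdf[OF s_ker y] D_cdf[OF s0_ker y] space_restrict_space)
      moreover have "real_distribution (K y)"
        using measurable_space[OF K(1), of y] y
        by (auto simp: space_prob_algebra space_restrict_space real_distribution_def real_distribution_axioms_def)
      ultimately show ?case
        unfolding \<gamma>_def D_def
        using kernel_prob_space[OF s_ker y] by (intro weak_limit_decode[OF U u0 r(1) C q])
    qed
    then show ?thesis using s(1) by blast
  qed
  ultimately show ?thesis using that by blast
qed

section \<open>Minimax for functions affine in each argument\<close>

text \<open>Convexity of \<open>A\<close> together with affinity of \<open>V\<close> in its first
  argument, without a vector space structure: policies are functions into measures, and a convex
  combination is known only through its effect on \<open>V\<close>.\<close>

definition mixable :: "'a set \<Rightarrow> 'b set \<Rightarrow> ('a \<Rightarrow> 'b \<Rightarrow> real) \<Rightarrow> bool" where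
  "mixable A B V \<longleftrightarrow> (\<forall>a\<in>A. \<forall>a'\<in>A. \<forall>l\<in>{0..1}. \<exists>c\<in>A. \<forall>b\<in>B. V c b = l * V a b + (1 - l) * V a' b)"

lemma mixableD:
  assumes "mixable A B V" "a \<in> A" "a' \<in> A" "0 \<le> l" "l \<le> 1"
  obtains c where "c \<in> A" "\<And>b. b \<in> B \<Longrightarrow> V c b = l * V a b + (1 - l) * V a' b"
  using assms unfolding mixable_def by (metis atLeastAtMost_iff)

lemma mixable_subset:
  assumes "mixable A B V" "B' \<subseteq> B"
  shows "mixable A B' V"
  unfolding mixable_def
proof (intro ballI)
  fix a a' and l :: real assume "a \<in> A" "a' \<in> A" "l \<in> {0..1}"
  then obtain c where "c \<in> A" "\<And>b. b \<in> B \<Longrightarrow> V c b = l * V a b + (1 - l) * V a' b"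
    using mixableD[OF assms(1), of a a' l] by auto
  then show "\<exists>c\<in>A. \<forall>b\<in>B'. V c b = l * V a b + (1 - l) * V a' b"
    using assms(2) by (intro bexI[of _ c]) auto
qed

text \<open>The pairs of payoffs against \<open>b1\<close> and \<open>b2\<close>, shifted by
  \<open>\<alpha>\<close>, form a convex subset of the plane that misses the open negative quadrant.
  A separating normal has nonnegative coordinates, and normalising it yields the mixing
  weight.\<close>

lemma mixable_two_point:
  assumes V: "mixable A B V" and b: "b1 \<in> B" "b2 \<in> B"
    and max: "\<And>a. a \<in> A \<Longrightarrow> \<alpha> \<le> V a b1 \<or> \<alpha> \<le> V a b2"
  shows "\<exists>l\<in>{0..1}. \<forall>a\<in>A. \<alpha> \<le> l * V a b1 + (1 - l) * V a b2"
proof -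
  define S where "S = (\<lambda>a. (V a b1 - \<alpha>, V a b2 - \<alpha>)) ` A"
  define H where "H = {..<0::real} \<times> {..<0::real}"
  have "convex H"
    by (auto simp: H_def intro!: convex_Times)
  have conv: "convex S"
  proof (rule convexI)
    fix z w :: "real \<times> real" and u v :: real assume z: "z \<in> S" "w \<in> S" "0 \<le> u" "0 \<le> v" "u + v = 1"
    then obtain a a' where a: "a \<in> A" "z = (V a b1 - \<alpha>, V a b2 - \<alpha>)" "a' \<in> A" "w = (V a' b1 - \<alpha>, V a' b2 - \<alpha>)"
      by (auto simp: S_def)
    have v: "v = 1 - u" "u \<le> 1" using z by auto
    obtain c where "c \<in> A" "\<And>b. b \<in> B \<Longrightarrow> V c b = u * V a b + (1 - u) * V a' b"
      using mixableD[OF V a(1,3) z(3) v(2)] by metis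
    then show "u *\<^sub>R z + v *\<^sub>R w \<in> S"
      unfolding S_def a v using b by (intro image_eqI[of _ _ c]) (auto simp: algebra_simps)
  qed
  show ?thesis
  proof (cases "A = {}")
    case False
    have "S \<inter> H = {}" using max by (force simp: S_def H_def)
    moreover have "S \<noteq> {}" "H \<noteq> {}" using False by (auto simp: S_def H_def lessThan_empty_iff)
    ultimately obtain p :: "real \<times> real" and c where p: "p \<noteq> 0" "\<And>h. h \<in> H \<Longrightarrow> p \<bullet> h \<le> c" "\<And>s. s \<in> S \<Longrightarrow> c \<le> p \<bullet> s"
      using separating_hyperplane_sets[of H S] \<open>convex H\<close> conv by (metis Int_commute)
    obtain p1 p2 where p12: "p = (p1, p2)" by (cases p)
    have lin: "- p1 * s - p2 * t \<le> c" if "s > 0" "t > 0" for s t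
      using p(2)[of "(- s, - t)"] that by (auto simp: H_def p12)
    have "((\<lambda>s. - p1 * s - p2 * s) \<longlongrightarrow> - p1 * 0 - p2 * 0) (at_right 0)"
      by (intro tendsto_intros)
    then have "- p1 * 0 - p2 * 0 \<le> c"
      by (rule tendsto_upperbound) (use lin in \<open>auto simp: eventually_at_filter intro!: always_eventually\<close>)
    then have c0: "0 \<le> c" by simp
    \<comment> \<open>A negative coordinate of \<open>p\<close> would make the functional unbounded
      above on \<open>H\<close>. The witnesses below are scaled so that its value exceeds
      \<open>c\<close> by at least 1.\<close>
    have nonneg: "0 \<le> p1" "0 \<le> p2"
    proof -
      show "0 \<le> p1"
      proof (rule ccontr)
        assume n: "\<not> 0 \<le> p1"
        then have "- p1 * ((c + \<bar>p2\<bar> + 1) / - p1) - p2 * 1 \<le> c"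
          using c0 by (intro lin) (auto simp: divide_pos_neg zero_less_divide_iff)
        then show False using n by (auto simp: abs_if split: if_splits)
      qed
      show "0 \<le> p2"
      proof (rule ccontr)
        assume n: "\<not> 0 \<le> p2"
        then have "- p1 * 1 - p2 * ((c + \<bar>p1\<bar> + 1) / - p2) \<le> c"
          using c0 by (intro lin) (auto simp: divide_pos_neg zero_less_divide_iff)
        then show False using n by (auto simp: abs_if split: if_splits)
      qed
    qed
    have pos: "0 < p1 + p2" using nonneg p(1) by (auto simp: p12 zero_prod_def)
    define l where "l = p1 / (p1 + p2)"
    have l1: "1 - l = p2 / (p1 + p2)" using pos by (simp add: l_def field_simps)
    have "\<alpha> \<le> l * V a b1 + (1 - l) * V a b2" if "a \<in> A" for a
    proof -
      have "0 \<le> p1 * (V a b1 - \<alpha>) + p2 * (V a b2 - \<alpha>)"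
        using p(3)[of "(V a b1 - \<alpha>, V a b2 - \<alpha>)"] that c0 by (auto simp: p12 S_def)
      then have "0 \<le> (p1 * (V a b1 - \<alpha>) + p2 * (V a b2 - \<alpha>)) / (p1 + p2)" using pos by simp
      also have "\<dots> = l * V a b1 + (1 - l) * V a b2 - \<alpha>"
      proof -
        have "p1 * (V a b1 - \<alpha>) + p2 * (V a b2 - \<alpha>) = p1 * V a b1 + p2 * V a b2 - \<alpha> * (p1 + p2)"
          by (simp add: algebra_simps)
        then show ?thesis
          unfolding l1 using pos by (simp add: l_def add_divide_distrib diff_divide_distrib)
      qed
      finally show ?thesis by simp
    qed
    moreover have "l \<in> {0..1}" using nonneg pos by (auto simp: l_def field_simps)
    ultimately show ?thesis by blast
  qed (auto intro!: exI[of _ 0])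
qed

text \<open>Induction on \<open>J\<close> that also shrinks \<open>A\<close>: on the strict sublevel
  set of \<open>x\<close>, which is again mixable, the other elements of \<open>J\<close> do the
  work and merge into one \<open>b\<close> by induction. The case of two strategies then merges
  \<open>x\<close> and \<open>b\<close>.\<close>

lemma mixable_finite_sup:
  assumes VA: "mixable A B V" and VB: "mixable B A (\<lambda>b a. V a b)"
    and J: "finite J" "J \<noteq> {}" "J \<subseteq> B"
    and max: "\<And>a. a \<in> A \<Longrightarrow> \<exists>b\<in>J. \<alpha> \<le> V a b"
  shows "\<exists>b\<in>B. \<forall>a\<in>A. \<alpha> \<le> V a b"
  using J VA max VB
proof (induction J arbitrary: A rule: finite_ne_induct)
  case (singleton x)
  then show ?case by blast
next
  case (insert x F)
  define A' where "A' = {a \<in> A. V a x < \<alpha>}"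
  have mono: "mixable B A' (\<lambda>b a. V a b)"
    by (rule mixable_subset[OF insert.prems(4)]) (simp add: A'_def)
  have "mixable A' B V"
    unfolding mixable_def
  proof (intro ballI)
    fix a a' and l :: real assume a: "a \<in> A'" "a' \<in> A'" "l \<in> {0..1}"
    then obtain c where c: "c \<in> A" "\<And>b. b \<in> B \<Longrightarrow> V c b = l * V a b + (1 - l) * V a' b"
      using mixableD[OF insert.prems(2), of a a' l] by (auto simp: A'_def)
    have "l * V a x + (1 - l) * V a' x < \<alpha>"
      using a by (intro convex_bound_lt) (auto simp: A'_def)
    then have "c \<in> A'" using c insert.prems(1) by (auto simp: A'_def)
    then show "\<exists>c\<in>A'. \<forall>b\<in>B. V c b = l * V a b + (1 - l) * V a' b" using c by blast
  qed
  moreover have "\<exists>b\<in>F. \<alpha> \<le> V a b" if "a \<in> A'" for a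
    using that insert.prems(3)[of a] by (auto simp: A'_def)
  ultimately obtain b where b: "b \<in> B" "\<And>a. a \<in> A' \<Longrightarrow> \<alpha> \<le> V a b"
    using insert.IH[of A'] insert.prems(1) mono by blast
  have "\<alpha> \<le> V a x \<or> \<alpha> \<le> V a b" if "a \<in> A" for a
    using b(2)[of a] that by (cases "V a x < \<alpha>") (auto simp: A'_def)
  then have "\<exists>l\<in>{0..1}. \<forall>a\<in>A. \<alpha> \<le> l * V a x + (1 - l) * V a b"
    using insert.prems(1) b(1) by (intro mixable_two_point[OF insert.prems(2)]) auto
  then obtain l where l: "0 \<le> l" "l \<le> 1" "\<And>a. a \<in> A \<Longrightarrow> \<alpha> \<le> l * V a x + (1 - l) * V a b"
    by (metis atLeastAtMost_iff)
  have x: "x \<in> B" using insert.prems(1) by simp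
  obtain d where "d \<in> B" "\<And>a. a \<in> A \<Longrightarrow> V a d = l * V a x + (1 - l) * V a b"
    by (rule mixableD[OF insert.prems(4) x b(1) l(1,2)]) blast
  then show ?case using l by (intro bexI[of _ d]) auto
qed

text \<open>The assumption \<open>cpt\<close> is the part of compactness of \<open>A\<close> that is needed: sublevel sets
  with the finite intersection property have a common point.\<close>
lemma minimax_optimal_strategy:
  assumes VA: "mixable A B V" and VB: "mixable B A (\<lambda>b a. V a b)"
    and ne: "A \<noteq> {}" and bd: "\<And>a b. a \<in> A \<Longrightarrow> b \<in> B \<Longrightarrow> \<bar>V a b\<bar> \<le> (c::real)"
    and cpt: "\<And>v. (\<And>J e. finite J \<Longrightarrow> J \<subseteq> B \<Longrightarrow> 0 < e \<Longrightarrow> \<exists>a\<in>A. \<forall>b\<in>J. V a b \<le> v + e)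
      \<Longrightarrow> \<exists>a\<in>A. \<forall>b\<in>B. V a b \<le> v"
  shows "\<exists>a\<in>A. \<forall>b\<in>B. V a b \<le> (SUP b\<in>B. INF a\<in>A. V a b)"
proof (rule cpt)
  fix J and e :: real assume J: "finite J" "J \<subseteq> B" "0 < e"
  let ?v = "SUP b\<in>B. INF a\<in>A. V a b"
  show "\<exists>a\<in>A. \<forall>b\<in>J. V a b \<le> ?v + e"
  proof (cases "J = {}")
    case False
    show ?thesis
    proof (rule ccontr)
      assume "\<not> ?thesis"
      then have "\<And>a. a \<in> A \<Longrightarrow> \<exists>b\<in>J. ?v + e \<le> V a b" by (meson linear)
      then obtain b where b: "b \<in> B" "\<And>a. a \<in> A \<Longrightarrow> ?v + e \<le> V a b"
        using mixable_finite_sup[OF VA VB J(1) False J(2), of "?v + e"] by blast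
      have "?v + e \<le> (INF a\<in>A. V a b)"
        using ne b by (intro cINF_greatest)
      also have "\<dots> \<le> ?v"
      proof (rule cSUP_upper[OF b(1)], rule bdd_aboveI2)
        fix b' assume b': "b' \<in> B"
        obtain a where a: "a \<in> A" using ne by blast
        have "(INF a\<in>A. V a b') \<le> V a b'"
          using a b' bd by (intro cINF_lower bdd_belowI2[of _ "- c"]) (auto simp: abs_le_iff minus_le_iff)
        then show "(INF a\<in>A. V a b') \<le> c" using bd[OF a b'] by linarith
      qed
      finally show False using J(3) by simp
    qed
  qed (use ne in auto)
qed

lemma mixable_uminus:
  assumes "mixable A B V"
  shows "mixable A B (\<lambda>a b. - V a b)"
  unfolding mixable_def
proof (intro ballI)
  fix a a' and l :: real assume "a \<in> A" "a' \<in> A" "l \<in> {0..1}"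
  then obtain c where "c \<in> A" "\<And>b. b \<in> B \<Longrightarrow> V c b = l * V a b + (1 - l) * V a' b"
    using mixableD[OF assms, of a a' l] by auto
  then show "\<exists>c\<in>A. \<forall>b\<in>B. - V c b = l * - V a b + (1 - l) * - V a' b"
    by (intro bexI[of _ c]) auto
qed

theorem saddle_point_exists:
  assumes VA: "mixable A B V" and VB: "mixable B A (\<lambda>b a. V a b)"
    and ne: "A \<noteq> {}" "B \<noteq> {}"
    and bd: "\<And>a b. a \<in> A \<Longrightarrow> b \<in> B \<Longrightarrow> \<bar>V a b\<bar> \<le> (c::real)"
    and cptA: "\<And>v. (\<And>J e. finite J \<Longrightarrow> J \<subseteq> B \<Longrightarrow> 0 < e \<Longrightarrow> \<exists>a\<in>A. \<forall>b\<in>J. V a b \<le> v + e)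
      \<Longrightarrow> \<exists>a\<in>A. \<forall>b\<in>B. V a b \<le> v"
    and cptB: "\<And>v. (\<And>J e. finite J \<Longrightarrow> J \<subseteq> A \<Longrightarrow> 0 < e \<Longrightarrow> \<exists>b\<in>B. \<forall>a\<in>J. - V a b \<le> v + e)
      \<Longrightarrow> \<exists>b\<in>B. \<forall>a\<in>A. - V a b \<le> v"
  obtains a0 b0 where "a0 \<in> A" "b0 \<in> B"
    "\<And>b. b \<in> B \<Longrightarrow> V a0 b \<le> V a0 b0" "\<And>a. a \<in> A \<Longrightarrow> V a0 b0 \<le> V a b0"
proof -
  let ?lo = "SUP b\<in>B. INF a\<in>A. V a b" and ?hi = "SUP a\<in>A. INF b\<in>B. - V a b"
  obtain a0 where a0: "a0 \<in> A" "\<And>b. b \<in> B \<Longrightarrow> V a0 b \<le> ?lo"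
    using minimax_optimal_strategy[of A B V c, OF VA VB ne(1) bd cptA] by blast
  have "\<exists>b\<in>B. \<forall>a\<in>A. - V a b \<le> ?hi"
    by (rule minimax_optimal_strategy[of B A "\<lambda>b a. - V a b" c])
      (use bd ne in \<open>auto intro!: mixable_uminus[OF VA] mixable_uminus[OF VB] cptB\<close>)
  then obtain b0 where b0: "b0 \<in> B" "\<And>a. a \<in> A \<Longrightarrow> - V a b0 \<le> ?hi" by blast
  \<comment> \<open>Weak duality, with \<open>?hi\<close> the negative of the upper value. It gives
    \<open>V a0 b \<le> ?lo \<le> - ?hi \<le> V a b0\<close>, so the two optimal strategies form a
    saddle point.\<close>
  have "?hi \<le> - ?lo"
  proof (rule cSUP_least[OF ne(1)])
    fix a assume a: "a \<in> A"
    have "?lo \<le> - (INF b\<in>B. - V a b)"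
    proof (rule cSUP_least[OF ne(2)])
      fix b assume b: "b \<in> B"
      have "(INF a\<in>A. V a b) \<le> V a b"
        using a b bd by (intro cINF_lower bdd_belowI2[of _ "- c"]) (auto simp: abs_le_iff minus_le_iff)
      moreover have "(INF b\<in>B. - V a b) \<le> - V a b"
        using a b bd by (intro cINF_lower bdd_belowI2[of _ "- c"]) (auto simp: abs_le_iff)
      ultimately show "(INF a\<in>A. V a b) \<le> - (INF b\<in>B. - V a b)" by linarith
    qed
    then show "(INF b\<in>B. - V a b) \<le> - ?lo" by linarith
  qed
  then have "V a0 b \<le> V a b0" if "a \<in> A" "b \<in> B" for a b
    using a0(2)[OF that(2)] b0(2)[OF that(1)] by linarith
  then show ?thesis using a0(1) b0(1) that by blast
qed

section \<open>Mixtures of kernels\<close>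

text \<open>Pushing \<open>L x\<close> forward along \<open>y \<mapsto> (x, y)\<close> moves the
  parameter from the integrand into the measure, where measurability of integration of a fixed
  function applies.\<close>

lemma integral_measurable_subprob_algebra2:
  fixes f :: "'a \<Rightarrow> 'b \<Rightarrow> real"
  assumes f[measurable]: "(\<lambda>(x, y). f x y) \<in> borel_measurable (M \<Otimes>\<^sub>M N)"
    and L[measurable]: "L \<in> M \<rightarrow>\<^sub>M subprob_algebra N"
  shows "(\<lambda>x. \<integral>y. f x y \<partial>L x) \<in> borel_measurable M"
proof -
  have "(\<lambda>x. distr (L x) (M \<Otimes>\<^sub>M N) (\<lambda>y. (x, y))) \<in> M \<rightarrow>\<^sub>M subprob_algebra (M \<Otimes>\<^sub>M N)"
    by (rule measurable_distr2[OF _ L]) simp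
  from measurable_compose[OF this integral_measurable_subprob_algebra[OF f]]
  have "(\<lambda>x. \<integral>z. (case z of (x, y) \<Rightarrow> f x y) \<partial>distr (L x) (M \<Otimes>\<^sub>M N) (\<lambda>y. (x, y))) \<in> borel_measurable M" .
  then show ?thesis
  proof (rule measurable_cong[THEN iffD1, rotated])
    fix x assume x: "x \<in> space M"
    have "(\<lambda>y. (x, y)) \<in> L x \<rightarrow>\<^sub>M M \<Otimes>\<^sub>M N"
      unfolding measurable_cong_sets[OF sets_kernel[OF L x] refl] using x by (rule measurable_Pair1')
    then show "(\<integral>z. (case z of (x, y) \<Rightarrow> f x y) \<partial>distr (L x) (M \<Otimes>\<^sub>M N) (\<lambda>y. (x, y))) = (\<integral>y. f x y \<partial>L x)"
      by (subst integral_distr[OF _ f]) simp_all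
  qed
qed

lemma (in prob_space) abs_integral_le:
  assumes "\<And>x. x \<in> space M \<Longrightarrow> \<bar>f x\<bar> \<le> (b::real)"
  shows "\<bar>\<integral>x. f x \<partial>M\<bar> \<le> b"
proof (cases "integrable M f")
  case True
  have "\<bar>\<integral>x. f x \<partial>M\<bar> \<le> (\<integral>x. \<bar>f x\<bar> \<partial>M)" by (rule integral_abs_bound)
  also have "\<dots> \<le> (\<integral>x. b \<partial>M)" using True assms by (intro integral_mono) auto
  finally show ?thesis by (simp add: prob_space)
next
  \<comment> \<open>A function that is not integrable has integral 0 by convention, and
    \<open>b\<close> is nonnegative because the space contains a point.\<close>
  case False
  obtain x where "x \<in> space M" using not_empty by blast
  then show ?thesis using assms[of x] False by (simp add: not_integrable_integral_eq)
qed

text \<open>The mixture is a coin toss followed by the selected kernel, so measurability comes from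
  that of the monadic bind. The integral formula makes the cost affine; the formula for sets
  supplies midpoints for \<open>kernel_convex_compactness\<close>.\<close>

lemma kernels_mix:
  assumes a: "a \<in> kernels Y U" and a': "a' \<in> kernels Y U" and l: "0 \<le> l" "l \<le> 1"
  obtains c where "c \<in> kernels Y U"
    "\<And>y f b. y \<in> Y \<Longrightarrow> f \<in> borel_measurable (bsp U) \<Longrightarrow> (\<And>u. u \<in> U \<Longrightarrow> \<bar>f u\<bar> \<le> (b::real)) \<Longrightarrow>
       (\<integral>u. f u \<partial>c y) = l * (\<integral>u. f u \<partial>a y) + (1 - l) * (\<integral>u. f u \<partial>a' y)"
    "\<And>y E. y \<in> Y \<Longrightarrow> E \<in> sets (bsp U) \<Longrightarrow> measure (c y) E = l * measure (a y) E + (1 - l) * measure (a' y) E"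
proof -
  define P where "P = measure_pmf (bernoulli_pmf l)"
  define k where "k y i = (if i then a y else a' y)" for y i
  define c where "c y = P \<bind> k y" for y
  have sP: "sets P = sets (count_space UNIV)" by (simp add: P_def)
  have P: "P \<in> space (prob_algebra (count_space UNIV))"
    by (simp add: P_def space_prob_algebra prob_space_measure_pmf)
  have [measurable]: "a \<in> bsp Y \<rightarrow>\<^sub>M prob_algebra (bsp U)" "a' \<in> bsp Y \<rightarrow>\<^sub>M prob_algebra (bsp U)"
    using a a' by (auto simp: kernels_def)
  have k_meas: "(\<lambda>(y, i). k y i) \<in> bsp Y \<Otimes>\<^sub>M count_space UNIV \<rightarrow>\<^sub>M prob_algebra (bsp U)"
    unfolding k_def by measurable
  have c: "c \<in> kernels Y U"
    unfolding c_def kernels_def using k_meas P by (intro measurable_bind_prob_space2 measurable_const)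
  have int: "(\<integral>u. f u \<partial>c y) = l * (\<integral>u. f u \<partial>a y) + (1 - l) * (\<integral>u. f u \<partial>a' y)"
    if y: "y \<in> Y" and f: "f \<in> borel_measurable (bsp U)" "\<And>u. u \<in> U \<Longrightarrow> \<bar>f u\<bar> \<le> (b::real)" for y f b
  proof -
    have k_sub: "k y \<in> P \<rightarrow>\<^sub>M subprob_algebra (bsp U)"
    proof -
      have "k y i \<in> space (subprob_algebra (bsp U))" for i
        using kernel_prob_space(1,2)[OF a y] kernel_prob_space(1,2)[OF a' y]
        by (cases i) (simp_all add: k_def space_subprob_algebra prob_space_imp_subprob_space)
      then show ?thesis
        unfolding measurable_cong_sets[OF sP refl] by simp
    qed
    have "(\<integral>u. f u \<partial>c y) = (\<integral>i. \<integral>u. f u \<partial>k y i \<partial>P)"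
      unfolding c_def
    proof (rule integral_bind[OF f(1) _ k_sub])
      show "finite_measure P" unfolding P_def by (rule measure_pmf.finite_measure)
      show "AE i in P. emeasure (k y i) (space (k y i)) \<le> ennreal 1"
        using subprob_space.emeasure_space_le_1[OF subprob_space_kernel[OF k_sub]] by (auto simp: P_def)
    qed (use f(2) in \<open>auto simp: space_restrict_space\<close>)
    also have "\<dots> = l * (\<integral>u. f u \<partial>a y) + (1 - l) * (\<integral>u. f u \<partial>a' y)"
      unfolding P_def using l by (simp add: k_def)
    finally show ?thesis .
  qed
  have "measure (c y) E = l * measure (a y) E + (1 - l) * measure (a' y) E"
    if y: "y \<in> Y" and E: "E \<in> sets (bsp U)" for y E
  proof -
    have m: "measure (d y) E = (\<integral>u. indicator E u \<partial>d y)" if "d \<in> kernels Y U" for d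
    proof -
      have "E \<subseteq> space (d y)"
        using sets.sets_into_space[OF E] kernel_prob_space(3)[OF that y] by (simp add: space_restrict_space)
      then show ?thesis by (simp add: Int_absorb2)
    qed
    show ?thesis
      unfolding m[OF a] m[OF a'] m[OF c] using E by (intro int[OF y, of _ 1]) (auto simp: indicator_def)
  qed
  with c int show ?thesis using that by blast
qed

text \<open>Indexing the sublevel sets by finite sets of pairs \<open>(b, e)\<close> makes each of
  them nonempty by \<open>fip\<close> and makes the family closed under intersection. The limit
  kernel satisfies every relaxed inequality by \<open>lim\<close>, and the slack is then sent to 0
  for each \<open>b\<close>.\<close>

lemma kernels_sublevel_compactness:
  fixes Y :: "'y::topological_space set" and U :: "'u::polish_space set"
    and V :: "('y \<Rightarrow> 'u measure) \<Rightarrow> 'b \<Rightarrow> real"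
  assumes U: "compact U" and Q: "prob_space Q" "sets Q = sets (bsp Y)"
    and lim: "\<And>b s \<gamma>. b \<in> B \<Longrightarrow> \<gamma> \<in> kernels Y U \<Longrightarrow> (\<And>n. s n \<in> kernels Y U) \<Longrightarrow>
      AE y in Q. weakly_to U (\<lambda>n. s n y) (\<gamma> y) \<Longrightarrow> (\<lambda>n. V (s n) b) \<longlonglongrightarrow> V \<gamma> b"
    and mid: "\<And>a a'. a \<in> kernels Y U \<Longrightarrow> a' \<in> kernels Y U \<Longrightarrow> \<exists>c\<in>kernels Y U.
      (\<forall>y\<in>Y. \<forall>E\<in>sets (bsp U). measure (c y) E = (measure (a y) E + measure (a' y) E) / 2) \<and>
      (\<forall>b\<in>B. V c b = (V a b + V a' b) / 2)"
    and fip: "\<And>J e. finite J \<Longrightarrow> J \<subseteq> B \<Longrightarrow> 0 < e \<Longrightarrow> \<exists>a\<in>kernels Y U. \<forall>b\<in>J. V a b \<le> v + e"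
  shows "\<exists>a\<in>kernels Y U. \<forall>b\<in>B. V a b \<le> v"
proof -
  define S where "S J = {a \<in> kernels Y U. \<forall>(b, e)\<in>J. V a b \<le> v + e}" for J
  define \<K> where "\<K> = S ` {J. finite J \<and> J \<subseteq> B \<times> {0<..}}"
  have S_ne: "S J \<noteq> {}" if J: "finite J" "J \<subseteq> B \<times> {0<..}" for J
  proof -
    \<comment> \<open>The inserted 1 keeps the minimum well defined and positive when
      \<open>J\<close> is empty.\<close>
    define e where "e = Min (insert 1 (snd ` J))"
    have fJ: "fst ` J \<subseteq> B" using J(2) by auto
    have "0 < e" using J by (auto simp: e_def)
    then obtain a where a: "a \<in> kernels Y U" "\<forall>b\<in>fst ` J. V a b \<le> v + e"
      using fip[of "fst ` J" e] J(1) fJ by (metis finite_imageI)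
    have "V a b \<le> v + e'" if "(b, e') \<in> J" for b e'
    proof -
      have "e \<le> e'" unfolding e_def using J(1) that by (intro Min_le) force+
      moreover have "V a b \<le> v + e" using a(2) that by force
      ultimately show ?thesis by linarith
    qed
    then show ?thesis using a(1) by (auto simp: S_def)
  qed
  obtain \<gamma> where \<gamma>: "\<gamma> \<in> kernels Y U"
    "\<And>K. K \<in> \<K> \<Longrightarrow> \<exists>s. (\<forall>n. s n \<in> K) \<and> (AE y in Q. weakly_to U (\<lambda>n. s n y) (\<gamma> y))"
  proof (rule kernel_convex_compactness[OF U Q, of \<K>])
    show "\<K> \<noteq> {}" unfolding \<K>_def by blast
    show "K \<noteq> {}" if "K \<in> \<K>" for K using that S_ne by (auto simp: \<K>_def)
    show "K \<subseteq> kernels Y U" if "K \<in> \<K>" for K using that by (auto simp: \<K>_def S_def)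
    fix K L assume "K \<in> \<K>" "L \<in> \<K>"
    then obtain J J' where J: "K = S J" "L = S J'" "finite (J \<union> J')" "J \<union> J' \<subseteq> B \<times> {0<..}"
      by (auto simp: \<K>_def)
    have "K \<inter> L = S (J \<union> J')" unfolding J(1,2) by (auto simp: S_def)
    then show "K \<inter> L \<in> \<K>" using J(3,4) unfolding \<K>_def by blast
  next
    fix K a a' assume "K \<in> \<K>" and a: "a \<in> K" "a' \<in> K"
    then obtain J where K: "K = S J" "J \<subseteq> B \<times> {0<..}" by (auto simp: \<K>_def)
    then obtain c where c: "c \<in> kernels Y U"
      "\<forall>y\<in>Y. \<forall>E\<in>sets (bsp U). measure (c y) E = (measure (a y) E + measure (a' y) E) / 2"
      "\<forall>b\<in>B. V c b = (V a b + V a' b) / 2"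
      using mid[of a a'] a by (auto simp: S_def)
    have "V c b \<le> v + e" if "(b, e) \<in> J" for b e
    proof -
      have "V a b \<le> v + e" "V a' b \<le> v + e" "b \<in> B" using a K that by (auto simp: S_def)
      then show ?thesis using c(3) by auto
    qed
    then have "c \<in> K" using c(1) K by (auto simp: S_def)
    then show "\<exists>c\<in>K. \<forall>y\<in>Y. \<forall>E\<in>sets (bsp U). measure (c y) E = (measure (a y) E + measure (a' y) E) / 2"
      using c(2) by blast
  qed blast
  have "V \<gamma> b \<le> v" if b: "b \<in> B" for b
  proof (rule field_le_epsilon)
    fix e :: real assume e: "0 < e"
    obtain s where s: "\<And>n. s n \<in> S {(b, e)}" "AE y in Q. weakly_to U (\<lambda>n. s n y) (\<gamma> y)"
      using \<gamma>(2)[of "S {(b, e)}"] b e by (auto simp: \<K>_def)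
    have "(\<lambda>n. V (s n) b) \<longlonglongrightarrow> V \<gamma> b"
      using s by (intro lim[OF b \<gamma>(1)]) (auto simp: S_def)
    then show "V \<gamma> b \<le> v + e"
      by (rule LIMSEQ_le_const2) (use s(1) in \<open>auto simp: S_def\<close>)
  qed
  then show ?thesis using \<gamma>(1) by blast
qed

section \<open>Saddle points of the expected cost\<close>

text \<open>One structure is fixed, so that the locale can be instantiated side by side for a
  structure and its garbling. The bound \<open>b\<close> depends on the game alone and is shared by
  both instances.\<close>

locale cost_game =
  fixes X :: "'x::polish_space set" and Y1 :: "'y1::polish_space set" and Y2 :: "'y2::polish_space set"
    and G :: "('x, 'u1::polish_space, 'u2::polish_space) game"
    and \<mu> :: "('x \<times> 'y1 \<times> 'y2) measure" and b :: real
  assumes compact_actions: "compact (actions1 G)" "compact (actions2 G)"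
    and cost_measurable: "(\<lambda>(x, u1, u2). cost G x u1 u2) \<in> borel_measurable (triple_space X (actions1 G) (actions2 G))"
    and cost_bound: "\<And>x u1 u2. x \<in> X \<Longrightarrow> u1 \<in> actions1 G \<Longrightarrow> u2 \<in> actions2 G \<Longrightarrow> \<bar>cost G x u1 u2\<bar> \<le> b"
    and cost_continuous: "\<And>x. x \<in> X \<Longrightarrow> continuous_on (actions1 G \<times> actions2 G) (\<lambda>(u1, u2). cost G x u1 u2)"
    and mu: "\<mu> \<in> space (prob_algebra (triple_space X Y1 Y2))"
begin

abbreviation "U1 \<equiv> actions1 G"
abbreviation "U2 \<equiv> actions2 G"
abbreviation "\<Gamma>1 \<equiv> kernels Y1 U1"
abbreviation "\<Gamma>2 \<equiv> kernels Y2 U2"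
abbreviation "V \<equiv> expected_cost G \<mu>"

definition inner_cost :: "('y2 \<Rightarrow> 'u2 measure) \<Rightarrow> 'x \<Rightarrow> 'y2 \<Rightarrow> 'u1 \<Rightarrow> real" where
  "inner_cost g2 x y2 u1 = (\<integral>u2. cost G x u1 u2 \<partial>g2 y2)"

definition outer_cost :: "('y1 \<Rightarrow> 'u1 measure) \<Rightarrow> ('y2 \<Rightarrow> 'u2 measure) \<Rightarrow> 'x \<times> 'y1 \<times> 'y2 \<Rightarrow> real" where
  "outer_cost g1 g2 z = (\<integral>u1. inner_cost g2 (fst z) (snd (snd z)) u1 \<partial>g1 (fst (snd z)))"

lemma V_eq: "V g1 g2 = (\<integral>z. outer_cost g1 g2 z \<partial>\<mu>)"
  unfolding expected_cost_def outer_cost_def inner_cost_def by (simp add: case_prod_beta')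

lemma prob_mu: "prob_space \<mu>" and sets_mu: "sets \<mu> = sets (triple_space X Y1 Y2)"
  using mu by (auto simp: space_prob_algebra)

sublocale prob_space \<mu> by (rule prob_mu)

lemma space_mu: "space \<mu> = X \<times> Y1 \<times> Y2"
  using sets_eq_imp_space_eq[OF sets_mu] by (simp add: space_pair_measure space_restrict_space)

lemma cost_section_measurable:
  assumes "x \<in> X" "u1 \<in> U1"
  shows "cost G x u1 \<in> borel_measurable (bsp U2)"
proof -
  have "(\<lambda>u2. (x, u1, u2)) \<in> bsp U2 \<rightarrow>\<^sub>M triple_space X U1 U2"
    using assms by (intro measurable_Pair measurable_const measurable_ident) (auto simp: space_restrict_space)
  from measurable_compose[OF this cost_measurable] show ?thesis by simp
qed

lemma inner_cost_bound:
  assumes "g2 \<in> \<Gamma>2" "x \<in> X" "y2 \<in> Y2" "u1 \<in> U1"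
  shows "\<bar>inner_cost g2 x y2 u1\<bar> \<le> b"
  unfolding inner_cost_def using assms cost_bound kernel_prob_space[OF assms(1,3)]
  by (intro prob_space.abs_integral_le) auto

text \<open>Dominated convergence over the action of player 2. Continuity in \<open>u1\<close>
  qualifies \<open>inner_cost\<close> as a test function for weak convergence of the laws of player
  1.\<close>

lemma inner_cost_continuous:
  assumes g2: "g2 \<in> \<Gamma>2" and x: "x \<in> X" and y2: "y2 \<in> Y2"
  shows "continuous_on U1 (inner_cost g2 x y2)"
  unfolding continuous_on_sequentially
proof (intro allI ballI impI, elim conjE)
  note k = kernel_prob_space[OF g2 y2]
  interpret k: prob_space "g2 y2" by (rule k)
  fix u :: "nat \<Rightarrow> 'u1" and a assume a: "a \<in> U1" and u: "\<forall>n. u n \<in> U1" "u \<longlonglongrightarrow> a"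
  have meas: "cost G x u1 \<in> borel_measurable (g2 y2)" if "u1 \<in> U1" for u1
    using cost_section_measurable[OF x that] unfolding measurable_cong_sets[OF k(2) refl] .
  have "(\<lambda>n. \<integral>u2. cost G x (u n) u2 \<partial>g2 y2) \<longlonglongrightarrow> (\<integral>u2. cost G x a u2 \<partial>g2 y2)"
  proof (rule integral_dominated_convergence[where w="\<lambda>_. b"])
    show "AE u2 in g2 y2. (\<lambda>n. cost G x (u n) u2) \<longlonglongrightarrow> cost G x a u2"
    proof (rule AE_I2)
      fix u2 assume u2: "u2 \<in> space (g2 y2)"
      then have "u2 \<in> U2" using k(3) by simp
      then have "(\<lambda>n. case (u n, u2) of (u1, u2) \<Rightarrow> cost G x u1 u2) \<longlonglongrightarrow> (case (a, u2) of (u1, u2) \<Rightarrow> cost G x u1 u2)"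
        using a u by (intro continuous_on_tendsto_compose[OF cost_continuous[OF x]] tendsto_Pair tendsto_const) auto
      then show "(\<lambda>n. cost G x (u n) u2) \<longlonglongrightarrow> cost G x a u2" by simp
    qed
    show "AE u2 in g2 y2. norm (cost G x (u n) u2) \<le> b" for n
      using cost_bound[OF x] u(1) k(3) by (intro AE_I2) auto
  qed (use meas a u in auto)
  then show "((inner_cost g2 x y2) \<circ> u) \<longlonglongrightarrow> inner_cost g2 x y2 a"
    by (simp add: inner_cost_def comp_def)
qed

lemma inner_cost_section_measurable:
  assumes "g2 \<in> \<Gamma>2" "x \<in> X" "y2 \<in> Y2"
  shows "inner_cost g2 x y2 \<in> borel_measurable (bsp U1)"
  using inner_cost_continuous[OF assms] by (rule borel_measurable_continuous_on_restrict)

lemma inner_cost_integrable: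
  assumes "g1 \<in> \<Gamma>1" "g2 \<in> \<Gamma>2" "x \<in> X" "y1 \<in> Y1" "y2 \<in> Y2"
  shows "integrable (g1 y1) (inner_cost g2 x y2)"
proof (rule prob_space.integrable_of_bounded)
  note k = kernel_prob_space[OF assms(1,4)]
  show "prob_space (g1 y1)" by (rule k)
  show "inner_cost g2 x y2 \<in> borel_measurable (g1 y1)"
    unfolding measurable_cong_sets[OF k(2) refl] using assms by (intro inner_cost_section_measurable)
  show "\<bar>inner_cost g2 x y2 u1\<bar> \<le> b" if "u1 \<in> space (g1 y1)" for u1
    using that assms k(3) by (intro inner_cost_bound) auto
qed

lemma inner_cost_measurable:
  assumes g2: "g2 \<in> \<Gamma>2"
  shows "(\<lambda>(z, u1). inner_cost g2 (fst z) (snd (snd z)) u1) \<in> borel_measurable (triple_space X Y1 Y2 \<Otimes>\<^sub>M bsp U1)"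
proof -
  have [measurable]: "g2 \<in> bsp Y2 \<rightarrow>\<^sub>M subprob_algebra (bsp U2)"
    using g2 by (auto simp: kernels_def measurable_prob_algebraD)
  have "(\<lambda>w. \<integral>u2. cost G (fst (fst w)) (snd w) u2 \<partial>g2 (snd (snd (fst w))))
      \<in> borel_measurable (triple_space X Y1 Y2 \<Otimes>\<^sub>M bsp U1)"
  proof (rule integral_measurable_subprob_algebra2[where N="bsp U2"])
    have "(\<lambda>p. (fst (fst (fst p)), snd (fst p), snd p))
        \<in> (triple_space X Y1 Y2 \<Otimes>\<^sub>M bsp U1) \<Otimes>\<^sub>M bsp U2 \<rightarrow>\<^sub>M triple_space X U1 U2"
      by measurable
    from measurable_compose[OF this cost_measurable]
    show "(\<lambda>(w, u2). cost G (fst (fst w)) (snd w) u2)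
        \<in> borel_measurable ((triple_space X Y1 Y2 \<Otimes>\<^sub>M bsp U1) \<Otimes>\<^sub>M bsp U2)"
      by (simp add: case_prod_beta')
    show "(\<lambda>w. g2 (snd (snd (fst w)))) \<in> triple_space X Y1 Y2 \<Otimes>\<^sub>M bsp U1 \<rightarrow>\<^sub>M subprob_algebra (bsp U2)"
      by measurable
  qed
  then show ?thesis by (simp add: inner_cost_def case_prod_beta')
qed

lemma outer_cost_measurable:
  assumes g1: "g1 \<in> \<Gamma>1" and g2: "g2 \<in> \<Gamma>2"
  shows "outer_cost g1 g2 \<in> borel_measurable (triple_space X Y1 Y2)"
proof -
  have [measurable]: "g1 \<in> bsp Y1 \<rightarrow>\<^sub>M subprob_algebra (bsp U1)"
    using g1 by (auto simp: kernels_def measurable_prob_algebraD)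
  have "(\<lambda>z. g1 (fst (snd z))) \<in> triple_space X Y1 Y2 \<rightarrow>\<^sub>M subprob_algebra (bsp U1)"
    by measurable
  from integral_measurable_subprob_algebra2[OF inner_cost_measurable[OF g2] this]
  show ?thesis unfolding outer_cost_def[abs_def] .
qed

lemma outer_cost_bound:
  assumes "g1 \<in> \<Gamma>1" "g2 \<in> \<Gamma>2" "z \<in> X \<times> Y1 \<times> Y2"
  shows "\<bar>outer_cost g1 g2 z\<bar> \<le> b"
proof -
  obtain x y1 y2 where z: "z = (x, y1, y2)" "x \<in> X" "y1 \<in> Y1" "y2 \<in> Y2" using assms(3) by auto
  note k = kernel_prob_space[OF assms(1) z(3)]
  show ?thesis
    unfolding outer_cost_def z(1) using inner_cost_bound[OF assms(2) z(2,4)] k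
    by (intro prob_space.abs_integral_le) auto
qed

lemma outer_cost_measurable_mu:
  assumes "g1 \<in> \<Gamma>1" "g2 \<in> \<Gamma>2"
  shows "outer_cost g1 g2 \<in> borel_measurable \<mu>"
  unfolding measurable_cong_sets[OF sets_mu refl] by (rule outer_cost_measurable[OF assms])

lemma outer_cost_integrable:
  assumes "g1 \<in> \<Gamma>1" "g2 \<in> \<Gamma>2"
  shows "integrable \<mu> (outer_cost g1 g2)"
  by (rule integrable_of_bounded[of _ b])
    (use assms outer_cost_measurable_mu outer_cost_bound in \<open>auto simp: space_mu\<close>)

lemma V_bound:
  assumes "g1 \<in> \<Gamma>1" "g2 \<in> \<Gamma>2"
  shows "\<bar>V g1 g2\<bar> \<le> b"
  unfolding V_eq using outer_cost_bound[OF assms] by (intro abs_integral_le) (auto simp: space_mu)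

lemma V_affine:
  assumes "g1 \<in> \<Gamma>1" "g2 \<in> \<Gamma>2" "h1 \<in> \<Gamma>1" "h2 \<in> \<Gamma>2"
    and "\<And>z. z \<in> X \<times> Y1 \<times> Y2 \<Longrightarrow> outer_cost k1 k2 z = l * outer_cost g1 g2 z + (1 - l) * outer_cost h1 h2 z"
  shows "V k1 k2 = l * V g1 g2 + (1 - l) * V h1 h2"
proof -
  have "V k1 k2 = (\<integral>z. l * outer_cost g1 g2 z + (1 - l) * outer_cost h1 h2 z \<partial>\<mu>)"
    unfolding V_eq using assms(5) by (intro Bochner_Integration.integral_cong) (auto simp: space_mu)
  then show ?thesis
    using outer_cost_integrable[OF assms(1,2)] outer_cost_integrable[OF assms(3,4)] by (simp add: V_eq)
qed

text \<open>Mixing takes place separately at each signal, so the same \<open>c\<close> works against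
  all policies of player 2.\<close>

lemma V_mix1:
  assumes a: "a \<in> \<Gamma>1" "a' \<in> \<Gamma>1" and l: "0 \<le> l" "l \<le> 1"
  obtains c where "c \<in> \<Gamma>1" "\<And>g2. g2 \<in> \<Gamma>2 \<Longrightarrow> V c g2 = l * V a g2 + (1 - l) * V a' g2"
    "\<And>y E. y \<in> Y1 \<Longrightarrow> E \<in> sets (bsp U1) \<Longrightarrow> measure (c y) E = l * measure (a y) E + (1 - l) * measure (a' y) E"
proof -
  obtain c where c: "c \<in> \<Gamma>1"
    "\<And>y f b. y \<in> Y1 \<Longrightarrow> f \<in> borel_measurable (bsp U1) \<Longrightarrow> (\<And>u. u \<in> U1 \<Longrightarrow> \<bar>f u\<bar> \<le> (b::real)) \<Longrightarrow>
       (\<integral>u. f u \<partial>c y) = l * (\<integral>u. f u \<partial>a y) + (1 - l) * (\<integral>u. f u \<partial>a' y)"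
    "\<And>y E. y \<in> Y1 \<Longrightarrow> E \<in> sets (bsp U1) \<Longrightarrow> measure (c y) E = l * measure (a y) E + (1 - l) * measure (a' y) E"
    using kernels_mix[OF a l] by metis
  have "V c g2 = l * V a g2 + (1 - l) * V a' g2" if g2: "g2 \<in> \<Gamma>2" for g2
  proof (rule V_affine[OF a(1) g2 a(2) g2])
    fix z assume "z \<in> X \<times> Y1 \<times> Y2"
    then obtain x y1 y2 where z: "z = (x, y1, y2)" "x \<in> X" "y1 \<in> Y1" "y2 \<in> Y2" by auto
    show "outer_cost c g2 z = l * outer_cost a g2 z + (1 - l) * outer_cost a' g2 z"
      unfolding outer_cost_def z(1) fst_conv snd_conv
      by (rule c(2)[OF z(3) inner_cost_section_measurable[OF g2 z(2,4)] inner_cost_bound[OF g2 z(2,4)]])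
  qed
  then show ?thesis using c(1,3) that by blast
qed

lemma V_mix2:
  assumes a: "a \<in> \<Gamma>2" "a' \<in> \<Gamma>2" and l: "0 \<le> l" "l \<le> 1"
  obtains c where "c \<in> \<Gamma>2" "\<And>g1. g1 \<in> \<Gamma>1 \<Longrightarrow> V g1 c = l * V g1 a + (1 - l) * V g1 a'"
    "\<And>y E. y \<in> Y2 \<Longrightarrow> E \<in> sets (bsp U2) \<Longrightarrow> measure (c y) E = l * measure (a y) E + (1 - l) * measure (a' y) E"
proof -
  obtain c where c: "c \<in> \<Gamma>2"
    "\<And>y f b. y \<in> Y2 \<Longrightarrow> f \<in> borel_measurable (bsp U2) \<Longrightarrow> (\<And>u. u \<in> U2 \<Longrightarrow> \<bar>f u\<bar> \<le> (b::real)) \<Longrightarrow>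
       (\<integral>u. f u \<partial>c y) = l * (\<integral>u. f u \<partial>a y) + (1 - l) * (\<integral>u. f u \<partial>a' y)"
    "\<And>y E. y \<in> Y2 \<Longrightarrow> E \<in> sets (bsp U2) \<Longrightarrow> measure (c y) E = l * measure (a y) E + (1 - l) * measure (a' y) E"
    using kernels_mix[OF a l] by metis
  have "V g1 c = l * V g1 a + (1 - l) * V g1 a'" if g1: "g1 \<in> \<Gamma>1" for g1
  proof (rule V_affine[OF g1 a(1) g1 a(2)])
    fix z assume "z \<in> X \<times> Y1 \<times> Y2"
    then obtain x y1 y2 where z: "z = (x, y1, y2)" "x \<in> X" "y1 \<in> Y1" "y2 \<in> Y2" by auto
    have "inner_cost c x y2 u1 = l * inner_cost a x y2 u1 + (1 - l) * inner_cost a' x y2 u1" if u1: "u1 \<in> U1" for u1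
      unfolding inner_cost_def by (rule c(2)[OF z(4) cost_section_measurable[OF z(2) u1] cost_bound[OF z(2) u1]])
    then have "outer_cost g1 c z = (\<integral>u1. l * inner_cost a x y2 u1 + (1 - l) * inner_cost a' x y2 u1 \<partial>g1 y1)"
      unfolding outer_cost_def z(1) fst_conv snd_conv using kernel_prob_space[OF g1 z(3)]
      by (intro Bochner_Integration.integral_cong) auto
    then show "outer_cost g1 c z = l * outer_cost g1 a z + (1 - l) * outer_cost g1 a' z"
      using inner_cost_integrable[OF g1 a(1) z(2-4)] inner_cost_integrable[OF g1 a(2) z(2-4)]
      by (simp add: outer_cost_def z(1))
  qed
  then show ?thesis using c(1,3) that by blast
qed

lemma V_tendsto:
  assumes "\<And>n. g n \<in> \<Gamma>1" "\<And>n. h n \<in> \<Gamma>2" "g' \<in> \<Gamma>1" "h' \<in> \<Gamma>2"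
    and "AE z in \<mu>. (\<lambda>n. outer_cost (g n) (h n) z) \<longlonglongrightarrow> outer_cost g' h' z"
  shows "(\<lambda>n. V (g n) (h n)) \<longlonglongrightarrow> V g' h'"
  unfolding V_eq
  by (rule integral_dominated_convergence[where w="\<lambda>_. b"])
    (use assms outer_cost_measurable_mu outer_cost_bound in \<open>auto simp: space_mu\<close>)

text \<open>The action of player 1 is integrated last, so at fixed state and signals weak
  convergence is tested directly against the continuous function \<open>inner_cost\<close>.\<close>

lemma V_tendsto1:
  assumes g: "\<And>n. g n \<in> \<Gamma>1" "g' \<in> \<Gamma>1" and h: "h \<in> \<Gamma>2"
    and lim: "AE y in distr \<mu> (bsp Y1) (\<lambda>z. fst (snd z)). weakly_to U1 (\<lambda>n. g n y) (g' y)"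
  shows "(\<lambda>n. V (g n) h) \<longlonglongrightarrow> V g' h"
proof (rule V_tendsto[OF g(1) h g(2) h])
  have "(\<lambda>z. fst (snd z)) \<in> \<mu> \<rightarrow>\<^sub>M bsp Y1"
    unfolding measurable_cong_sets[OF sets_mu refl] by measurable
  from AE_distrD[OF this lim] AE_space
  show "AE z in \<mu>. (\<lambda>n. outer_cost (g n) h z) \<longlonglongrightarrow> outer_cost g' h z"
  proof eventually_elim
    case (elim z)
    then show ?case
      using inner_cost_continuous[OF h, of "fst z" "snd (snd z)"] by (auto simp: weakly_to_def outer_cost_def space_mu)
  qed
qed

text \<open>The varying law now sits under the integral over \<open>u1\<close>. Weak convergence is
  applied to the section of the cost at each \<open>u1\<close>, and dominated convergence carries
  the limit through the law of player 1.\<close>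

lemma V_tendsto2:
  assumes g: "g \<in> \<Gamma>1" and h: "\<And>n. h n \<in> \<Gamma>2" "h' \<in> \<Gamma>2"
    and lim: "AE y in distr \<mu> (bsp Y2) (\<lambda>z. snd (snd z)). weakly_to U2 (\<lambda>n. h n y) (h' y)"
  shows "(\<lambda>n. V g (h n)) \<longlonglongrightarrow> V g h'"
proof (rule V_tendsto[OF g h(1) g h(2)])
  have "(\<lambda>z. snd (snd z)) \<in> \<mu> \<rightarrow>\<^sub>M bsp Y2"
    unfolding measurable_cong_sets[OF sets_mu refl] by measurable
  from AE_distrD[OF this lim] AE_space
  show "AE z in \<mu>. (\<lambda>n. outer_cost g (h n) z) \<longlonglongrightarrow> outer_cost g h' z"
  proof eventually_elim
    case (elim z)
    then obtain x y1 y2 where z: "z = (x, y1, y2)" "x \<in> X" "y1 \<in> Y1" "y2 \<in> Y2" by (auto simp: space_mu)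
    note k = kernel_prob_space[OF g z(3)]
    interpret k: prob_space "g y1" by (rule k)
    have w: "weakly_to U2 (\<lambda>n. h n y2) (h' y2)" using elim z by simp
    have meas: "inner_cost d x y2 \<in> borel_measurable (g y1)" if "d \<in> \<Gamma>2" for d
      unfolding measurable_cong_sets[OF k(2) refl] using that z by (intro inner_cost_section_measurable)
    have "(\<lambda>n. \<integral>u1. inner_cost (h n) x y2 u1 \<partial>g y1) \<longlonglongrightarrow> (\<integral>u1. inner_cost h' x y2 u1 \<partial>g y1)"
    proof (rule integral_dominated_convergence[where w="\<lambda>_. b"])
      show "AE u1 in g y1. (\<lambda>n. inner_cost (h n) x y2 u1) \<longlonglongrightarrow> inner_cost h' x y2 u1"
      proof (rule AE_I2)
        fix u1 assume "u1 \<in> space (g y1)"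
        then have u1: "u1 \<in> U1" using k(3) by simp
        have "continuous_on U2 (\<lambda>u2. case (u1, u2) of (u1, u2) \<Rightarrow> cost G x u1 u2)"
          using u1 by (intro continuous_on_compose2[OF cost_continuous[OF z(2)]] continuous_intros) auto
        then show "(\<lambda>n. inner_cost (h n) x y2 u1) \<longlonglongrightarrow> inner_cost h' x y2 u1"
          using w by (simp add: weakly_to_def inner_cost_def)
      qed
      show "AE u1 in g y1. norm (inner_cost (h n) x y2 u1) \<le> b" for n
        using inner_cost_bound[OF h(1) z(2,4)] k(3) by (intro AE_I2) auto
    qed (use meas h in auto)
    then show ?case by (simp add: outer_cost_def z(1))
  qed
qed

lemma V_saddle:
  assumes ne: "\<Gamma>1 \<noteq> {}" "\<Gamma>2 \<noteq> {}"
  obtains g1 g2 where "g1 \<in> \<Gamma>1" "g2 \<in> \<Gamma>2"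
    "\<And>h. h \<in> \<Gamma>2 \<Longrightarrow> V g1 h \<le> V g1 g2" "\<And>g. g \<in> \<Gamma>1 \<Longrightarrow> V g1 g2 \<le> V g g2"
proof -
  \<comment> \<open>A policy sees only its own signal, so the exceptional null sets of policy
    convergence are measured by the law of that signal under \<open>\<mu>\<close>.\<close>
  let ?Q1 = "distr \<mu> (bsp Y1) (\<lambda>z. fst (snd z))" and ?Q2 = "distr \<mu> (bsp Y2) (\<lambda>z. snd (snd z))"
  have m: "(\<lambda>z. fst (snd z)) \<in> \<mu> \<rightarrow>\<^sub>M bsp Y1" "(\<lambda>z. snd (snd z)) \<in> \<mu> \<rightarrow>\<^sub>M bsp Y2"
    unfolding measurable_cong_sets[OF sets_mu refl] by measurable
  have Q: "prob_space ?Q1" "prob_space ?Q2" using m by (auto intro: prob_space_distr)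
  have half: "1 - 1 / 2 = (1 / 2 :: real)" "(0::real) \<le> 1/2" "(1/2::real) \<le> 1" by auto
  have cpt1: "\<exists>g\<in>\<Gamma>1. \<forall>h\<in>\<Gamma>2. V g h \<le> v"
    if "\<And>J e. finite J \<Longrightarrow> J \<subseteq> \<Gamma>2 \<Longrightarrow> 0 < e \<Longrightarrow> \<exists>g\<in>\<Gamma>1. \<forall>h\<in>J. V g h \<le> v + e" for v
  proof (rule kernels_sublevel_compactness[OF compact_actions(1) Q(1)])
    fix a a' assume "a \<in> \<Gamma>1" "a' \<in> \<Gamma>1"
    from V_mix1[OF this half(2,3)] obtain c where "c \<in> \<Gamma>1"
      "\<And>g2. g2 \<in> \<Gamma>2 \<Longrightarrow> V c g2 = 1/2 * V a g2 + (1 - 1/2) * V a' g2"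
      "\<And>y E. y \<in> Y1 \<Longrightarrow> E \<in> sets (bsp U1) \<Longrightarrow> measure (c y) E = 1/2 * measure (a y) E + (1 - 1/2) * measure (a' y) E"
      by metis
    then show "\<exists>c\<in>\<Gamma>1. (\<forall>y\<in>Y1. \<forall>E\<in>sets (bsp U1). measure (c y) E = (measure (a y) E + measure (a' y) E) / 2) \<and>
        (\<forall>h\<in>\<Gamma>2. V c h = (V a h + V a' h) / 2)"
      unfolding half(1) by (intro bexI[of _ c] conjI ballI) (auto simp: add_divide_distrib)
  qed (use V_tendsto1 that in auto)
  have cpt2: "\<exists>h\<in>\<Gamma>2. \<forall>g\<in>\<Gamma>1. - V g h \<le> v"
    if "\<And>J e. finite J \<Longrightarrow> J \<subseteq> \<Gamma>1 \<Longrightarrow> 0 < e \<Longrightarrow> \<exists>h\<in>\<Gamma>2. \<forall>g\<in>J. - V g h \<le> v + e" for v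
  proof (rule kernels_sublevel_compactness[OF compact_actions(2) Q(2), where V="\<lambda>h g. - V g h"])
    fix a a' assume "a \<in> \<Gamma>2" "a' \<in> \<Gamma>2"
    from V_mix2[OF this half(2,3)] obtain c where "c \<in> \<Gamma>2"
      "\<And>g1. g1 \<in> \<Gamma>1 \<Longrightarrow> V g1 c = 1/2 * V g1 a + (1 - 1/2) * V g1 a'"
      "\<And>y E. y \<in> Y2 \<Longrightarrow> E \<in> sets (bsp U2) \<Longrightarrow> measure (c y) E = 1/2 * measure (a y) E + (1 - 1/2) * measure (a' y) E"
      by metis
    then show "\<exists>c\<in>\<Gamma>2. (\<forall>y\<in>Y2. \<forall>E\<in>sets (bsp U2). measure (c y) E = (measure (a y) E + measure (a' y) E) / 2) \<and>
        (\<forall>g\<in>\<Gamma>1. - V g c = (- V g a + - V g a') / 2)"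
      unfolding half(1) by (intro bexI[of _ c] conjI ballI) (auto simp: add_divide_distrib)
  qed (use V_tendsto2 that in \<open>auto intro!: tendsto_minus\<close>)
  have "mixable \<Gamma>1 \<Gamma>2 V"
    unfolding mixable_def using V_mix1 by (metis atLeastAtMost_iff)
  moreover have "mixable \<Gamma>2 \<Gamma>1 (\<lambda>h g. V g h)"
    unfolding mixable_def using V_mix2 by (metis atLeastAtMost_iff)
  ultimately show ?thesis
    by (rule saddle_point_exists[OF _ _ ne V_bound cpt1 cpt2 that])
qed

end

section \<open>Garbling and the game value\<close>

lemma integral_bind_prob_algebra:
  fixes f :: "'b \<Rightarrow> real"
  assumes M: "prob_space M" and K: "K \<in> M \<rightarrow>\<^sub>M prob_algebra N"
    and f: "f \<in> borel_measurable N" "\<And>x. x \<in> space N \<Longrightarrow> \<bar>f x\<bar> \<le> b"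
  shows "(\<integral>x. f x \<partial>(M \<bind> K)) = (\<integral>y. \<integral>x. f x \<partial>K y \<partial>M)"
proof (rule integral_bind[OF f measurable_prob_algebraD[OF K]])
  show "finite_measure M" using M by (rule prob_space.finite_measure)
  show "AE y in M. emeasure (K y) (space (K y)) \<le> ennreal 1"
    using subprob_space.emeasure_space_le_1[OF subprob_space_kernel[OF measurable_prob_algebraD[OF K]]]
    by (intro AE_I2) simp
qed

context cost_game
begin

text \<open>Infima and suprema of reals carry information only over bounded sets;
  \<open>V_bound\<close> supplies the bounds on both sides.\<close>

lemma equilibrium_iff_saddle:
  "equilibrium Y1 Y2 G \<mu> g1 g2 \<longleftrightarrow> g1 \<in> \<Gamma>1 \<and> g2 \<in> \<Gamma>2 \<and>
     (\<forall>g\<in>\<Gamma>1. V g1 g2 \<le> V g g2) \<and> (\<forall>h\<in>\<Gamma>2. V g1 h \<le> V g1 g2)"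
proof (cases "g1 \<in> \<Gamma>1 \<and> g2 \<in> \<Gamma>2")
  case True
  then have g: "g1 \<in> \<Gamma>1" "g2 \<in> \<Gamma>2" by auto
  have below: "bdd_below ((\<lambda>g. V g g2) ` \<Gamma>1)"
    using V_bound[OF _ g(2)] by (intro bdd_belowI2[of _ "- b"]) (simp add: abs_le_iff minus_le_iff)
  have above: "bdd_above (V g1 ` \<Gamma>2)"
    using V_bound[OF g(1)] by (intro bdd_aboveI2[of _ _ b]) (simp add: abs_le_iff)
  have "(INF g\<in>\<Gamma>1. V g g2) = V g1 g2 \<longleftrightarrow> (\<forall>g\<in>\<Gamma>1. V g1 g2 \<le> V g g2)"
  proof
    assume "(INF g\<in>\<Gamma>1. V g g2) = V g1 g2"
    then show "\<forall>g\<in>\<Gamma>1. V g1 g2 \<le> V g g2" using cINF_lower[OF below] by metis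
  next
    assume "\<forall>g\<in>\<Gamma>1. V g1 g2 \<le> V g g2"
    then show "(INF g\<in>\<Gamma>1. V g g2) = V g1 g2" using g(1) by (intro cInf_eq_minimum) auto
  qed
  moreover have "V g1 g2 = (SUP h\<in>\<Gamma>2. V g1 h) \<longleftrightarrow> (\<forall>h\<in>\<Gamma>2. V g1 h \<le> V g1 g2)"
  proof
    assume "V g1 g2 = (SUP h\<in>\<Gamma>2. V g1 h)"
    then show "\<forall>h\<in>\<Gamma>2. V g1 h \<le> V g1 g2" using cSUP_upper[OF _ above] by metis
  next
    assume "\<forall>h\<in>\<Gamma>2. V g1 h \<le> V g1 g2"
    then show "V g1 g2 = (SUP h\<in>\<Gamma>2. V g1 h)" using g(2) by (intro cSup_eq_maximum[symmetric]) auto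
  qed
  ultimately show ?thesis using g unfolding equilibrium_def by blast
qed (auto simp: equilibrium_def)

lemma game_value_saddle:
  assumes "\<Gamma>1 \<noteq> {}" "\<Gamma>2 \<noteq> {}"
  obtains g1 g2 where "g1 \<in> \<Gamma>1" "g2 \<in> \<Gamma>2" "game_value Y1 Y2 G \<mu> = V g1 g2"
    "\<And>h. h \<in> \<Gamma>2 \<Longrightarrow> V g1 h \<le> V g1 g2" "\<And>g. g \<in> \<Gamma>1 \<Longrightarrow> V g1 g2 \<le> V g g2"
proof -
  obtain g1 g2 where g: "g1 \<in> \<Gamma>1" "g2 \<in> \<Gamma>2"
    "\<And>h. h \<in> \<Gamma>2 \<Longrightarrow> V g1 h \<le> V g1 g2" "\<And>g. g \<in> \<Gamma>1 \<Longrightarrow> V g1 g2 \<le> V g g2"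
    using V_saddle[OF assms] by metis
  have "game_value Y1 Y2 G \<mu> = V g1 g2"
    unfolding game_value_def
  proof (rule the_equality)
    show "\<exists>\<gamma>1 \<gamma>2. equilibrium Y1 Y2 G \<mu> \<gamma>1 \<gamma>2 \<and> V g1 g2 = V \<gamma>1 \<gamma>2"
      using g by (auto simp: equilibrium_iff_saddle)
    fix v assume "\<exists>\<gamma>1 \<gamma>2. equilibrium Y1 Y2 G \<mu> \<gamma>1 \<gamma>2 \<and> v = V \<gamma>1 \<gamma>2"
    then obtain h1 h2 where h: "h1 \<in> \<Gamma>1" "h2 \<in> \<Gamma>2" "v = V h1 h2"
      "\<And>h. h \<in> \<Gamma>2 \<Longrightarrow> V h1 h \<le> V h1 h2" "\<And>g. g \<in> \<Gamma>1 \<Longrightarrow> V h1 h2 \<le> V g h2"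
      by (auto simp: equilibrium_iff_saddle)
    \<comment> \<open>Two saddle points are compared through the crossed pairs: \<open>V g1 g2 \<le>
      V h1 g2 \<le> V h1 h2 \<le> V g1 h2 \<le> V g1 g2\<close>.\<close>
    show "v = V g1 g2"
      using g(3)[OF h(2)] g(4)[OF h(1)] h(4)[OF g(2)] h(5)[OF g(1)] h(3) by linarith
  qed
  then show ?thesis using g that by blast
qed

lemma triple_section_measurable:
  shows "x \<in> X \<Longrightarrow> y2 \<in> Y2 \<Longrightarrow> (\<lambda>y1. (x, y1, y2)) \<in> bsp Y1 \<rightarrow>\<^sub>M triple_space X Y1 Y2"
    and "x \<in> X \<Longrightarrow> y1 \<in> Y1 \<Longrightarrow> (\<lambda>y2. (x, y1, y2)) \<in> bsp Y2 \<rightarrow>\<^sub>M triple_space X Y1 Y2"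
  by (intro measurable_Pair measurable_const measurable_ident; simp add: space_restrict_space)+

text \<open>The action of player 1 is the outer of the two action integrals, so resampling the
  signal and then acting merge into one bind without any change in the order of integration.\<close>

lemma expected_cost_garble1:
  assumes k: "\<kappa> \<in> kernels Y1 Y1" and g1: "g1 \<in> \<Gamma>1" and g2: "g2 \<in> \<Gamma>2"
  shows "expected_cost G (garble1 X Y1 Y2 \<kappa> \<mu>) g1 g2 = V (\<lambda>y. \<kappa> y \<bind> g1) g2"
proof -
  let ?M = "triple_space X Y1 Y2"
  have [measurable]: "\<kappa> \<in> bsp Y1 \<rightarrow>\<^sub>M prob_algebra (bsp Y1)" using k by (simp add: kernels_def)
  have K: "(\<lambda>(x, y1, y2). \<kappa> y1 \<bind> (\<lambda>y1'. return ?M (x, y1', y2))) \<in> \<mu> \<rightarrow>\<^sub>M prob_algebra ?M"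
    unfolding measurable_cong_sets[OF sets_mu refl] by measurable
  have "expected_cost G (garble1 X Y1 Y2 \<kappa> \<mu>) g1 g2 = (\<integral>w. outer_cost g1 g2 w \<partial>garble1 X Y1 Y2 \<kappa> \<mu>)"
    unfolding expected_cost_def outer_cost_def inner_cost_def by (simp add: case_prod_beta')
  also have "\<dots> = (\<integral>z. \<integral>w. outer_cost g1 g2 w \<partial>(case z of (x, y1, y2) \<Rightarrow> \<kappa> y1 \<bind> (\<lambda>y1'. return ?M (x, y1', y2))) \<partial>\<mu>)"
    unfolding garble1_def
    by (rule integral_bind_prob_algebra[OF prob_mu K outer_cost_measurable[OF g1 g2] outer_cost_bound[OF g1 g2]])
      (simp add: space_pair_measure space_restrict_space)
  also have "\<dots> = (\<integral>z. outer_cost (\<lambda>y. \<kappa> y \<bind> g1) g2 z \<partial>\<mu>)"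
  proof (rule Bochner_Integration.integral_cong[OF refl])
    fix z assume "z \<in> space \<mu>"
    then obtain x y1 y2 where z: "z = (x, y1, y2)" "x \<in> X" "y1 \<in> Y1" "y2 \<in> Y2" by (auto simp: space_mu)
    note ky = kernel_prob_space[OF k z(3)]
    have f: "(\<lambda>y1'. (x, y1', y2)) \<in> \<kappa> y1 \<rightarrow>\<^sub>M ?M"
      unfolding measurable_cong_sets[OF ky(2) refl] using z by (intro triple_section_measurable)
    have "(\<integral>w. outer_cost g1 g2 w \<partial>(\<kappa> y1 \<bind> (\<lambda>y1'. return ?M (x, y1', y2)))) = (\<integral>w. outer_cost g1 g2 w \<partial>distr (\<kappa> y1) ?M (\<lambda>y1'. (x, y1', y2)))"
      using ky z(3) by (subst bind_return_distr'[OF _ f]) auto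
    also have "\<dots> = (\<integral>y1'. outer_cost g1 g2 (x, y1', y2) \<partial>\<kappa> y1)"
      by (rule integral_distr[OF f outer_cost_measurable[OF g1 g2]])
    also have "\<dots> = (\<integral>u1. inner_cost g2 x y2 u1 \<partial>(\<kappa> y1 \<bind> g1))"
      unfolding outer_cost_def fst_conv snd_conv
    proof (rule integral_bind_prob_algebra[OF ky(1), symmetric])
      show "g1 \<in> \<kappa> y1 \<rightarrow>\<^sub>M prob_algebra (bsp U1)"
        unfolding measurable_cong_sets[OF ky(2) refl] using g1 by (simp add: kernels_def)
    qed (use inner_cost_section_measurable[OF g2 z(2,4)] inner_cost_bound[OF g2 z(2,4)] in \<open>auto simp: space_restrict_space\<close>)
    finally show "(\<integral>w. outer_cost g1 g2 w \<partial>(case z of (x, y1, y2) \<Rightarrow> \<kappa> y1 \<bind> (\<lambda>y1'. return ?M (x, y1', y2))))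
        = outer_cost (\<lambda>y. \<kappa> y \<bind> g1) g2 z"
      by (simp add: z(1) outer_cost_def)
  qed
  finally show ?thesis by (simp add: V_eq)
qed

text \<open>Unlike for player 1, the resampled signal of player 2 has to be integrated before the
  action of player 1, hence the use of Fubini's theorem.\<close>
lemma expected_cost_garble2:
  assumes k: "\<kappa> \<in> kernels Y2 Y2" and g1: "g1 \<in> \<Gamma>1" and g2: "g2 \<in> \<Gamma>2"
  shows "expected_cost G (garble2 X Y1 Y2 \<kappa> \<mu>) g1 g2 = V g1 (\<lambda>y. \<kappa> y \<bind> g2)"
proof -
  let ?M = "triple_space X Y1 Y2"
  have [measurable]: "\<kappa> \<in> bsp Y2 \<rightarrow>\<^sub>M prob_algebra (bsp Y2)" using k by (simp add: kernels_def)
  have K: "(\<lambda>(x, y1, y2). \<kappa> y2 \<bind> (\<lambda>y2'. return ?M (x, y1, y2'))) \<in> \<mu> \<rightarrow>\<^sub>M prob_algebra ?M"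
    unfolding measurable_cong_sets[OF sets_mu refl] by measurable
  have "expected_cost G (garble2 X Y1 Y2 \<kappa> \<mu>) g1 g2 = (\<integral>w. outer_cost g1 g2 w \<partial>garble2 X Y1 Y2 \<kappa> \<mu>)"
    unfolding expected_cost_def outer_cost_def inner_cost_def by (simp add: case_prod_beta')
  also have "\<dots> = (\<integral>z. \<integral>w. outer_cost g1 g2 w \<partial>(case z of (x, y1, y2) \<Rightarrow> \<kappa> y2 \<bind> (\<lambda>y2'. return ?M (x, y1, y2'))) \<partial>\<mu>)"
    unfolding garble2_def
    by (rule integral_bind_prob_algebra[OF prob_mu K outer_cost_measurable[OF g1 g2] outer_cost_bound[OF g1 g2]])
      (simp add: space_pair_measure space_restrict_space)
  also have "\<dots> = (\<integral>z. outer_cost g1 (\<lambda>y. \<kappa> y \<bind> g2) z \<partial>\<mu>)"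
  proof (rule Bochner_Integration.integral_cong[OF refl])
    fix z assume "z \<in> space \<mu>"
    then obtain x y1 y2 where z: "z = (x, y1, y2)" "x \<in> X" "y1 \<in> Y1" "y2 \<in> Y2" by (auto simp: space_mu)
    note ky = kernel_prob_space[OF k z(4)] and gy = kernel_prob_space[OF g1 z(3)]
    interpret ky: prob_space "\<kappa> y2" by (rule ky)
    interpret gy: prob_space "g1 y1" by (rule gy)
    interpret P: pair_prob_space "g1 y1" "\<kappa> y2" ..
    have f: "(\<lambda>y2'. (x, y1, y2')) \<in> \<kappa> y2 \<rightarrow>\<^sub>M ?M"
      unfolding measurable_cong_sets[OF ky(2) refl] using z by (intro triple_section_measurable)
    \<comment> \<open>Joint measurability in the action of player 1 and the resampled signal, as
      needed to swap the two integrals, comes from \<open>inner_cost_measurable\<close> by freezing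
      the state and the signal of player 1.\<close>
    have "(\<lambda>p. ((x, y1, snd p), fst p)) \<in> bsp U1 \<Otimes>\<^sub>M bsp Y2 \<rightarrow>\<^sub>M ?M \<Otimes>\<^sub>M bsp U1"
      by (rule measurable_Pair[OF measurable_compose[OF measurable_snd triple_section_measurable(2)[OF z(2,3)]]
            measurable_fst])
    from measurable_compose[OF this inner_cost_measurable[OF g2]]
    have "(\<lambda>(u1, y). inner_cost g2 x y u1) \<in> borel_measurable (bsp U1 \<Otimes>\<^sub>M bsp Y2)"
      by (simp add: case_prod_beta')
    then have meas: "(\<lambda>(u1, y). inner_cost g2 x y u1) \<in> borel_measurable (g1 y1 \<Otimes>\<^sub>M \<kappa> y2)"
      unfolding measurable_cong_sets[OF sets_pair_measure_cong[OF gy(2) ky(2)] refl] .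
    have "(\<integral>w. outer_cost g1 g2 w \<partial>(\<kappa> y2 \<bind> (\<lambda>y2'. return ?M (x, y1, y2')))) = (\<integral>w. outer_cost g1 g2 w \<partial>distr (\<kappa> y2) ?M (\<lambda>y2'. (x, y1, y2')))"
      using ky z(4) by (subst bind_return_distr'[OF _ f]) auto
    also have "\<dots> = (\<integral>y. outer_cost g1 g2 (x, y1, y) \<partial>\<kappa> y2)"
      by (rule integral_distr[OF f outer_cost_measurable[OF g1 g2]])
    also have "\<dots> = (\<integral>y. \<integral>u1. inner_cost g2 x y u1 \<partial>g1 y1 \<partial>\<kappa> y2)"
      by (simp add: outer_cost_def)
    also have "\<dots> = (\<integral>u1. \<integral>y. inner_cost g2 x y u1 \<partial>\<kappa> y2 \<partial>g1 y1)"
    proof (rule P.Fubini_integral, rule P.integrable_of_bounded[OF meas])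
      show "\<bar>case p of (u1, y) \<Rightarrow> inner_cost g2 x y u1\<bar> \<le> b" if "p \<in> space (g1 y1 \<Otimes>\<^sub>M \<kappa> y2)" for p
        using that inner_cost_bound[OF g2 z(2)] by (auto simp: space_pair_measure gy(3) ky(3))
    qed
    also have "\<dots> = (\<integral>u1. inner_cost (\<lambda>y. \<kappa> y \<bind> g2) x y2 u1 \<partial>g1 y1)"
    proof (rule Bochner_Integration.integral_cong[OF refl])
      fix u1 assume "u1 \<in> space (g1 y1)"
      then have u1: "u1 \<in> U1" by (simp add: gy(3))
      show "(\<integral>y. inner_cost g2 x y u1 \<partial>\<kappa> y2) = inner_cost (\<lambda>y. \<kappa> y \<bind> g2) x y2 u1"
        unfolding inner_cost_def
      proof (rule integral_bind_prob_algebra[OF ky(1), symmetric])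
        show "g2 \<in> \<kappa> y2 \<rightarrow>\<^sub>M prob_algebra (bsp U2)"
          unfolding measurable_cong_sets[OF ky(2) refl] using g2 by (simp add: kernels_def)
      qed (use cost_section_measurable[OF z(2) u1] cost_bound[OF z(2) u1] in \<open>auto simp: space_restrict_space\<close>)
    qed
    finally show "(\<integral>w. outer_cost g1 g2 w \<partial>(case z of (x, y1, y2) \<Rightarrow> \<kappa> y2 \<bind> (\<lambda>y2'. return ?M (x, y1, y2'))))
        = outer_cost g1 (\<lambda>y. \<kappa> y \<bind> g2) z"
      by (simp add: z(1) outer_cost_def)
  qed
  finally show ?thesis by (simp add: V_eq)
qed

end

lemma kernels_bind:
  assumes "\<kappa> \<in> kernels S S" "g \<in> kernels S T"
  shows "(\<lambda>y. \<kappa> y \<bind> g) \<in> kernels S T"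
  using assms unfolding kernels_def by (rule measurable_bind_prob_space)

text \<open>Without policies no equilibrium exists for any structure, so both definite descriptions
  range over the empty predicate and denote the same unspecified real. This covers games with an
  empty action set.\<close>

lemma game_value_no_policies:
  assumes "kernels Y1 (actions1 G) = {} \<or> kernels Y2 (actions2 G) = {}"
  shows "game_value Y1 Y2 G \<mu> = game_value Y1 Y2 G \<nu>"
  using assms by (auto simp: game_value_def equilibrium_def)

text \<open>The saddle points of the two structures are compared through a crossed pair. In the
  first claim, player 1 moves to the policy \<open>m1\<close> optimal under \<open>\<mu>\<close>,
  which cannot lower the cost under \<open>\<nu>\<close>; the simulated \<open>n2\<close> is then a
  reply to \<open>m1\<close> under \<open>\<mu>\<close>, which cannot beat \<open>m2\<close>. The
  second claim exchanges the players.\<close>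

lemma game_value_garble:
  fixes G :: "('x::polish_space, 'u1::polish_space, 'u2::polish_space) game"
    and Y1 :: "'y1::polish_space set" and Y2 :: "'y2::polish_space set"
  assumes G: "G \<in> compact_games X"
    and mu: "\<mu> \<in> space (prob_algebra (triple_space X Y1 Y2))"
    and nu: "\<nu> \<in> space (prob_algebra (triple_space X Y1 Y2))"
  shows "\<kappa> \<in> kernels Y2 Y2 \<Longrightarrow> \<nu> = garble2 X Y1 Y2 \<kappa> \<mu> \<Longrightarrow> game_value Y1 Y2 G \<nu> \<le> game_value Y1 Y2 G \<mu>"
    and "\<kappa>' \<in> kernels Y1 Y1 \<Longrightarrow> \<nu> = garble1 X Y1 Y2 \<kappa>' \<mu> \<Longrightarrow> game_value Y1 Y2 G \<mu> \<le> game_value Y1 Y2 G \<nu>"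
proof -
  obtain b where "\<forall>x\<in>X. \<forall>u1\<in>actions1 G. \<forall>u2\<in>actions2 G. \<bar>cost G x u1 u2\<bar> \<le> b"
    using G by (auto simp: compact_games_def)
  then have cost_game: "cost_game X Y1 Y2 G m b" if "m \<in> space (prob_algebra (triple_space X Y1 Y2))" for m
    using G that by unfold_locales (auto simp: compact_games_def)
  interpret M: cost_game X Y1 Y2 G \<mu> b using mu by (rule cost_game)
  interpret N: cost_game X Y1 Y2 G \<nu> b using nu by (rule cost_game)
  show "game_value Y1 Y2 G \<nu> \<le> game_value Y1 Y2 G \<mu>"
    if k: "\<kappa> \<in> kernels Y2 Y2" and nu_eq: "\<nu> = garble2 X Y1 Y2 \<kappa> \<mu>"
  proof (cases "kernels Y1 (actions1 G) = {} \<or> kernels Y2 (actions2 G) = {}")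
    case False
    then have ne: "kernels Y1 (actions1 G) \<noteq> {}" "kernels Y2 (actions2 G) \<noteq> {}" by auto
    obtain m1 m2 where m: "m1 \<in> M.\<Gamma>1" "m2 \<in> M.\<Gamma>2" "game_value Y1 Y2 G \<mu> = expected_cost G \<mu> m1 m2"
      "\<And>h. h \<in> M.\<Gamma>2 \<Longrightarrow> expected_cost G \<mu> m1 h \<le> expected_cost G \<mu> m1 m2"
      using M.game_value_saddle[OF ne] by metis
    obtain n1 n2 where n: "n1 \<in> M.\<Gamma>1" "n2 \<in> M.\<Gamma>2" "game_value Y1 Y2 G \<nu> = expected_cost G \<nu> n1 n2"
      "\<And>g. g \<in> M.\<Gamma>1 \<Longrightarrow> expected_cost G \<nu> n1 n2 \<le> expected_cost G \<nu> g n2"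
      using N.game_value_saddle[OF ne] by metis
    have "expected_cost G \<nu> n1 n2 \<le> expected_cost G \<nu> m1 n2" using m(1) by (rule n(4))
    also have "\<dots> = expected_cost G \<mu> m1 (\<lambda>y. \<kappa> y \<bind> n2)"
      unfolding nu_eq by (rule M.expected_cost_garble2[OF k m(1) n(2)])
    also have "\<dots> \<le> expected_cost G \<mu> m1 m2" using kernels_bind[OF k n(2)] by (rule m(4))
    finally show ?thesis by (simp add: m n)
  qed (intro eq_refl game_value_no_policies)
  show "game_value Y1 Y2 G \<mu> \<le> game_value Y1 Y2 G \<nu>"
    if k: "\<kappa>' \<in> kernels Y1 Y1" and nu_eq: "\<nu> = garble1 X Y1 Y2 \<kappa>' \<mu>"
  proof (cases "kernels Y1 (actions1 G) = {} \<or> kernels Y2 (actions2 G) = {}")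
    case False
    then have ne: "kernels Y1 (actions1 G) \<noteq> {}" "kernels Y2 (actions2 G) \<noteq> {}" by auto
    obtain m1 m2 where m: "m1 \<in> M.\<Gamma>1" "m2 \<in> M.\<Gamma>2" "game_value Y1 Y2 G \<mu> = expected_cost G \<mu> m1 m2"
      "\<And>g. g \<in> M.\<Gamma>1 \<Longrightarrow> expected_cost G \<mu> m1 m2 \<le> expected_cost G \<mu> g m2"
      using M.game_value_saddle[OF ne] by metis
    obtain n1 n2 where n: "n1 \<in> M.\<Gamma>1" "n2 \<in> M.\<Gamma>2" "game_value Y1 Y2 G \<nu> = expected_cost G \<nu> n1 n2"
      "\<And>h. h \<in> M.\<Gamma>2 \<Longrightarrow> expected_cost G \<nu> n1 h \<le> expected_cost G \<nu> n1 n2"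
      using N.game_value_saddle[OF ne] by metis
    have "expected_cost G \<mu> m1 m2 \<le> expected_cost G \<mu> (\<lambda>y. \<kappa>' y \<bind> n1) m2"
      using kernels_bind[OF k n(1)] by (rule m(4))
    also have "\<dots> = expected_cost G \<nu> n1 m2"
      unfolding nu_eq by (rule M.expected_cost_garble1[OF k n(1) m(2), symmetric])
    also have "\<dots> \<le> expected_cost G \<nu> n1 n2" using m(2) by (rule n(4))
    finally show ?thesis by (simp add: m n)
  qed (intro eq_refl game_value_no_policies)
qed

theorem corollary4p5:
  fixes X :: "'x::polish_space set"
    and Y1 :: "'y1::polish_space set" and Y2 :: "'y2::polish_space set"
    and \<zeta> :: "'x measure"
    and \<mu> \<nu> :: "('x \<times> 'y1 \<times> 'y2) measure"
  assumes "X \<in> sets borel" and "compact Y1" and "compact Y2"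
    and "\<zeta> \<in> prob_measures X"
    and "\<mu> \<in> info_structures X Y1 Y2 \<zeta>" and "ac_product X Y1 Y2 \<zeta> \<mu>"
    and "\<nu> \<in> info_structures X Y1 Y2 \<zeta>" and "ac_product X Y1 Y2 \<zeta> \<nu>"
  shows "((\<exists>\<kappa>2 \<in> kernels Y2 Y2. \<nu> = garble2 X Y1 Y2 \<kappa>2 \<mu>) \<longrightarrow>
            (\<forall>G \<in> (compact_games X :: ('x, 'u1::polish_space, 'u2::polish_space) game set).
               game_value Y1 Y2 G \<mu> \<ge> game_value Y1 Y2 G \<nu>)) \<and>
         ((\<exists>\<kappa>1 \<in> kernels Y1 Y1. \<nu> = garble1 X Y1 Y2 \<kappa>1 \<mu>) \<longrightarrow>
            (\<forall>G \<in> (compact_games X :: ('x, 'u1, 'u2) game set).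
               game_value Y1 Y2 G \<mu> \<le> game_value Y1 Y2 G \<nu>))"
proof -
  have "\<mu> \<in> space (prob_algebra (triple_space X Y1 Y2))" "\<nu> \<in> space (prob_algebra (triple_space X Y1 Y2))"
    using assms by (auto simp: info_structures_def)
  then show ?thesis by (metis game_value_garble)
qed

end
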